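(* Let $a>0$ be fixed. For an arbitrary positive constant $\delta$, as $n\to\infty$, $$C^{(a)}_n(ny)=(-1)^n e^{\frac{a}{1-y}}\,\frac{\Gamma(n-ny)}{\Gamma(-ny)}\left[1+O\left(\frac1n\right)\right]+\varepsilon_1\qquad\text{for } |y-1|>\delta,$$ uniformly for complex $y$ in this region, where the remainder $\varepsilon_1$ (the term $K_s(x)C_s(n,x)$ described in the context when $|y|<1$) is exponentially small, as compared with the leading term $(-1)^n e^{\frac{a}{1-y}}\Gamma(n-ny)/\Gamma(-ny)$, when $|y-[0,1]|>r$, for arbitrary positive $r$.
   Context: For fixed $a>0$ the monic Charlier polynomials are $C^{(a)}_n(x)=\sum_{k=0}^n\binom nk\binom xk k!\,(-a)^{n-k}$; equivalently $C^{(a)}_{-1}=0$, $C^{(a)}_0=1$ and $$xC^{(a)}_n(x)=C^{(a)}_{n+1}(x)+(n+a)C^{(a)}_n(x)+an\,C^{(a)}_{n-1}(x),\quad n=0,1,2,\dots.$$ Here $x=ny$, $|y-[0,1]|$ denotes the distance from the complex number $y$ to the segment $[0,1]$, and the quotient $\Gamma(n-x)/\Gamma(-x)$ is understood by analytic continuation, e.g. via $(-1)^n\frac{\Gamma(n-x)}{\Gamma(-x)}=\frac{\Gamma(x+1)}{\Gamma(1+x-n)}$. For $|y|<1$, $\varepsilon_1=K_s(x)C_s(n,x)$ in the following sense. $C_d(n,x)$ and $C_s(n,x)$ are linearly independent (dominant and subdominant) solutions $u(n)$, in $n$, of the three-term recurrence $x\,u(n)=u(n+1)+(n+a)\,u(n)+an\,u(n-1)$,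 such that, for every $N\ge1$, as $n\to\infty$, uniformly for $|y|\le\rho$ with arbitrary $\rho\in(0,1)$, $$C_d(n,x)=(-1)^n\Gamma(n-x)\Big[\sum_{k=0}^{N-1}\frac{\varphi_k(y)}{n^k}+O(n^{-N})\Big],\qquad C_s(n,x)=(-a)^n\frac{\Gamma(n+1)}{\Gamma(n-x+1)}\Big[\sum_{k=0}^{N-1}\frac{\psi_k(y)}{n^k}+O(n^{-N})\Big],$$ with $\varphi_k,\psi_k$ independent of $n$ and analytic in $|y|<1$, and with leading behavior for large $n$ (and large $n-x$; $x$ finite in the first case) $C_d(n,x)\sim(-1)^n\Gamma(n-x)$ and $C_s(n,x)\sim(-a)^n\frac{\Gamma(n+1)}{\Gamma(n-x+1)}\exp\left(-\frac{an}{n-x}\right)$ up to a constant factor. The functions $K_d(x)$, $K_s(x)$, independent of $n$, are determined by $C^{(a)}_n(x)=K_d(x)C_d(n,x)+K_s(x)C_s(n,x)$. *)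

theory Defs
  imports "HOL-Complex_Analysis.Complex_Analysis"
begin

definition charlier :: "real \<Rightarrow> nat \<Rightarrow> complex \<Rightarrow> complex" where
  "charlier a n x =
     (\<Sum>k\<le>n. of_nat (n choose k) * (x gchoose k) * fact k * (- of_real a) ^ (n - k))"

lemma charlier_0: "charlier a 0 x = 1"
  by (simp add: charlier_def)

text \<open>For \<open>n = 0\<close> the truncated \<open>n - 1\<close> is harmless, as that term is multiplied by \<open>n\<close>.\<close>

lemma charlier_recurrence:
  "x * charlier a n x =
     charlier a (Suc n) x + (of_nat n + of_real a) * charlier a n x
       + of_real a * of_nat n * charlier a (n - 1) x"
proof -
  define f where "f k = (x gchoose k) * fact k" for k
  define c :: complex where "c = - of_real a"
  have ch: "charlier a m x = (\<Sum>k\<le>m. of_nat (m choose k) * c ^ (m - k) * f k)" for m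
    by (simp add: charlier_def f_def c_def mult_ac)
  have f_Suc: "x * f k = f (Suc k) + of_nat k * f k" for k
  proof -
    have "x * f k = (x * (x gchoose k)) * fact k"
      by (simp add: f_def)
    also have "\<dots> = f (Suc k) + of_nat k * f k"
      by (subst gbinomial_mult_1) (simp add: f_def algebra_simps)
    finally show ?thesis .
  qed
  have A: "charlier a (Suc n) x
      = c * charlier a n x + (\<Sum>k\<le>n. of_nat (n choose k) * c ^ (n - k) * f (Suc k))"
  proof -
    have "charlier a (Suc n) x = c ^ Suc n * f 0
        + (\<Sum>k\<le>n. of_nat (Suc n choose Suc k) * c ^ (n - k) * f (Suc k))"
      unfolding ch by (subst sum.atMost_Suc_shift) simp
    also have "(\<Sum>k\<le>n. of_nat (Suc n choose Suc k) * c ^ (n - k) * f (Suc k))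
        = (\<Sum>k\<le>n. of_nat (n choose k) * c ^ (n - k) * f (Suc k))
        + (\<Sum>k\<le>n. of_nat (n choose Suc k) * c ^ (n - k) * f (Suc k))"
      by (simp add: algebra_simps sum.distrib)
    also have "(\<Sum>k\<le>n. of_nat (n choose Suc k) * c ^ (n - k) * f (Suc k))
        = (\<Sum>k\<le>Suc n. of_nat (n choose k) * c ^ (Suc n - k) * f k) - c ^ Suc n * f 0"
      by (subst sum.atMost_Suc_shift) simp
    also have "(\<Sum>k\<le>Suc n. of_nat (n choose k) * c ^ (Suc n - k) * f k) = c * charlier a n x"
      by (simp add: ch sum_distrib_left Suc_diff_le mult_ac)
    finally show ?thesis by simp
  qed
  have B: "(\<Sum>k\<le>n. of_nat k * (of_nat (n choose k) * c ^ (n - k) * f k))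
      = of_nat n * charlier a n x - c * of_nat n * charlier a (n - 1) x"
  proof (cases n)
    case (Suc m)
    have *: "of_nat (Suc m - k) * of_nat (Suc m choose k) = (of_nat (Suc m) * of_nat (m choose k) :: complex)"
      for k
      using binomial_absorb_comp[of "Suc m" k] by (metis diff_Suc_1 of_nat_mult)
    have "of_nat n * charlier a n x - (\<Sum>k\<le>n. of_nat k * (of_nat (n choose k) * c ^ (n - k) * f k))
        = (\<Sum>k\<le>Suc m. of_nat (Suc m - k) * of_nat (Suc m choose k) * c ^ (Suc m - k) * f k)"
      unfolding ch Suc sum_distrib_left sum_subtractf[symmetric]
      by (intro sum.cong refl) (simp add: of_nat_diff algebra_simps)
    also have "\<dots> = (\<Sum>k\<le>m. of_nat (Suc m) * of_nat (m choose k) * c ^ (Suc m - k) * f k)"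
      unfolding * by (subst sum.atMost_Suc) simp
    also have "\<dots> = c * of_nat n * charlier a (n - 1) x"
      unfolding ch Suc sum_distrib_left
      by (intro sum.cong) (simp_all add: Suc_diff_le mult_ac)
    finally show ?thesis by (simp add: algebra_simps)
  qed simp
  have "x * charlier a n x = (\<Sum>k\<le>n. of_nat (n choose k) * c ^ (n - k) * (x * f k))"
    by (simp add: ch sum_distrib_left mult_ac)
  also have "\<dots> = (\<Sum>k\<le>n. of_nat (n choose k) * c ^ (n - k) * f (Suc k))
      + (\<Sum>k\<le>n. of_nat k * (of_nat (n choose k) * c ^ (n - k) * f k))"
    by (simp add: f_Suc algebra_simps sum.distrib)
  finally show ?thesis
    using A B by (simp add: c_def algebra_simps)
qed

text \<open>
  The quotient \<open>\<Gamma>(n - x) / \<Gamma>(- x)\<close>, continued analytically across its removable singularities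
  \<open>x = 0, 1, 2, \<dots>\<close>, where the library's convention \<open>Gamma = 0\<close> at poles would give a wrong value.
\<close>

definition Gamma_quot :: "nat \<Rightarrow> complex \<Rightarrow> complex" where
  "Gamma_quot n = remove_sings (\<lambda>x. Gamma (of_nat n - x) / Gamma (- x))"

lemma Gamma_quot_eq_pochhammer: "Gamma_quot n x = pochhammer (- x) n"
proof -
  have ev: "\<forall>\<^sub>F z in at x. - z \<notin> \<int>\<^sub>\<le>\<^sub>0"
  proof -
    have "\<not> x islimpt \<int>"
    proof (rule discrete_imp_not_islimpt[of 1])
      fix u v :: complex
      assume "u \<in> \<int>" "v \<in> \<int>" "dist v u < 1"
      then obtain i j where "u = of_int i" "v = of_int j" "cmod (of_int (j - i)) < 1"
        by (auto elim!: Ints_cases simp: dist_norm)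
      then show "v = u"
        unfolding norm_of_int by simp
    qed simp
    then have "\<forall>\<^sub>F z in at x. z \<notin> \<int>"
      using islimpt_iff_eventually[of x "\<int>"] by blast
    then show ?thesis
      by eventually_elim (metis minus_in_Ints_iff nonpos_Ints_Int)
  qed
  have "((\<lambda>z. pochhammer (- z) n) \<longlongrightarrow> pochhammer (- x) n) (at x)"
    unfolding pochhammer_prod by (intro tendsto_intros)
  moreover have "\<forall>\<^sub>F z in at x. pochhammer (- z) n = Gamma (of_nat n - z) / Gamma (- z)"
    using ev by eventually_elim (subst pochhammer_Gamma, auto simp: algebra_simps)
  ultimately have "(\<lambda>z. Gamma (of_nat n - z) / Gamma (- z)) \<midarrow>x\<rightarrow> pochhammer (- x) n"
    by (rule Lim_transform_eventually)
  then show ?thesis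
    unfolding Gamma_quot_def by (rule remove_sings_eqI)
qed

text \<open>
  \<open>u n x = g n x * (\<Sum>k<N. c k y / n ^ k + O(n ^ (-N)))\<close> with \<open>x = n y\<close>, for every \<open>N \<ge> 1\<close>,
  uniformly for \<open>\<bar>y\<bar> \<le> \<rho>\<close> with arbitrary \<open>0 < \<rho> < 1\<close>.
\<close>

definition uniform_expansion ::
  "(nat \<Rightarrow> complex \<Rightarrow> complex) \<Rightarrow> (nat \<Rightarrow> complex \<Rightarrow> complex) \<Rightarrow> (nat \<Rightarrow> complex \<Rightarrow> complex) \<Rightarrow> bool"
  where
  "uniform_expansion u g c \<longleftrightarrow>
     (\<forall>k. c k analytic_on ball 0 1) \<and>
     (\<forall>N\<ge>1. \<forall>\<rho>. 0 < \<rho> \<and> \<rho> < 1 \<longrightarrow>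
        (\<exists>M. \<forall>\<^sub>F n in sequentially. \<forall>y. cmod y \<le> \<rho> \<longrightarrow>
           (\<exists>\<eta>. cmod \<eta> \<le> M / real n ^ N \<and>
              u n (of_nat n * y) =
                g n (of_nat n * y) * ((\<Sum>k<N. c k y / of_nat n ^ k) + \<eta>))))"

text \<open>
  Imposing the recurrence only for \<open>n \<ge> 1\<close> leaves \<open>u 0\<close> and \<open>u 1\<close> free, so that the solution
  space is two-dimensional for each \<open>x\<close>.
\<close>

definition charlier_rec :: "real \<Rightarrow> (nat \<Rightarrow> complex \<Rightarrow> complex) \<Rightarrow> bool" where
  "charlier_rec a u \<longleftrightarrow>
     (\<forall>n\<ge>1. \<forall>x. x * u n x =
        u (Suc n) x + (of_nat n + of_real a) * u n x + of_real a * of_nat n * u (n - 1) x)"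

definition dominant_scale :: "nat \<Rightarrow> complex \<Rightarrow> complex" where
  "dominant_scale n x = (-1) ^ n * Gamma (of_nat n - x)"

definition subdominant_scale :: "real \<Rightarrow> nat \<Rightarrow> complex \<Rightarrow> complex" where
  "subdominant_scale a n x =
     (- of_real a) ^ n * (Gamma (of_nat n + 1) / Gamma (of_nat n - x + 1))"

definition charlier_solution_pair ::
  "real \<Rightarrow> (nat \<Rightarrow> complex \<Rightarrow> complex) \<Rightarrow> (nat \<Rightarrow> complex \<Rightarrow> complex) \<Rightarrow> bool" where
  "charlier_solution_pair a Cd Cs \<longleftrightarrow>
     charlier_rec a Cd \<and> charlier_rec a Cs \<and>
     (\<forall>x \<alpha> \<beta>. (\<forall>n. \<alpha> * Cd n x + \<beta> * Cs n x = 0) \<longrightarrow> \<alpha> = 0 \<and> \<beta> = 0) \<and>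
     (\<forall>x. (\<lambda>n. Cs n x / Cd n x) \<longlonglongrightarrow> 0) \<and>
     (\<exists>\<phi>. uniform_expansion Cd dominant_scale \<phi>) \<and>
     (\<exists>\<psi>. uniform_expansion Cs (subdominant_scale a) \<psi>) \<and>
     (\<exists>c. c \<noteq> 0 \<and> (\<forall>x. (\<lambda>n. Cd n x / dominant_scale n x) \<longlonglongrightarrow> c)) \<and>
     (\<exists>c. c \<noteq> 0 \<and> (\<forall>\<rho>. 0 < \<rho> \<and> \<rho> < 1 \<longrightarrow>
        uniform_limit (cball 0 \<rho>)
          (\<lambda>n y. let x = of_nat n * y in
             Cs n x / (subdominant_scale a n x * exp (- (of_real a * of_nat n / (of_nat n - x)))))
          (\<lambda>_. c) sequentially))"

definition charlier_leading :: "real \<Rightarrow> nat \<Rightarrow> complex \<Rightarrow> complex" where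
  "charlier_leading a n y =
     (-1) ^ n * exp (of_real a / (1 - y)) * Gamma_quot n (of_nat n * y)"

end

theory Submission
  imports Defs
begin

text \<open>
  Away from the nodes \<open>0, 1, 2, \<dots>\<close> one has \<open>C\<^sub>n(x) = (-1)\<^sup>n (-x)\<^sub>n S\<close>, where \<open>S\<close> is a terminating
  series with terms \<open>a\<^sup>k / k!\<close> times products of \<open>k\<close> factors that are rational in \<open>1 / n\<close>; at
  \<open>1 / n = 0\<close> it becomes \<open>exp (a / (1 - y))\<close>. The Kummer series of the subdominant solution has the
  same shape. The Taylor coefficients of the \<open>k\<close>-th product in \<open>1 / n\<close> grow like \<open>D\<^sup>k k\<^sup>m\<close>, which the
  factor \<open>1 / k!\<close> absorbs, and this yields all the uniform expansions.

  At a node \<open>m\<close> the Charlier polynomial is \<open>(-a)\<^sup>-\<^sup>m\<close> times the subdominant solution. So the choice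
  \<open>K\<^sub>s = (-a)\<^sup>-\<^sup>m\<close> on the disc of radius \<open>1 / 2\<close> around \<open>m\<close>, and \<open>K\<^sub>s = 0\<close> elsewhere, together with
  \<open>K\<^sub>d(x) = 1 / \<Gamma>(-x)\<close>, makes the singularities of the dominant solution removable. On the circles
  the subdominant term is superexponentially small, and the maximum modulus principle carries
  the expansion into the discs.
\<close>

section \<open>Products of rational factors and their Taylor coefficients\<close>

text \<open>The obstacle is uniformity on |y| <= \<rho>: this region contains a number of nodes
  proportional to n, where the quotient Gamma(n-x)/Gamma(-x) vanishes and the Charlier polynomial in
  general does not, so no multiplicative expansion of the polynomial alone survives there. K_s only
  has to be independent of n; nothing asks it to be continuous, which permits a definition by cases.
  Discs of radius 1/2 are disjoint, and their circles keep distance at least 1/2 from every node. On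
  the circle around m, (-z)_n has the size of m! (n-m-1)! and the subdominant term that of
  n!/(n-m)!, up to exponential factors; the quotient is then of the size 1/(n-m-1)!. Hence m has to
  stay below a fixed fraction of n, and |y| < 1 with |1-y| >= \<delta> ensures this through Re(1-y)
  >= \<delta>^2/2. Since K_s vanishes off the discs, the remainder is identically zero at distance
  more than r from [0,1] as soon as n r >= 1.\<close>

definition hyp_prod :: "nat \<Rightarrow> complex \<Rightarrow> complex \<Rightarrow> complex \<Rightarrow> complex" where
  "hyp_prod k u w t = (\<Prod>j<k. w * (u + of_nat j * t) / (1 + of_nat (Suc j) * w * t))"

text \<open>Taylor coefficients of \<open>hyp_prod k u w t\<close> in t at 0. The last equation
  compares the coefficients of t^(m+1) in (1 + (k+1) w t) P_(k+1) = w (u + k t) P_k, where P_k is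
  the k-th product.\<close>

fun hyp_coeff :: "nat \<Rightarrow> nat \<Rightarrow> complex \<Rightarrow> complex \<Rightarrow> complex" where
  "hyp_coeff 0 m u w = (if m = 0 then 1 else 0)"
| "hyp_coeff (Suc k) 0 u w = w * u * hyp_coeff k 0 u w"
| "hyp_coeff (Suc k) (Suc m) u w =
     w * u * hyp_coeff k (Suc m) u w + w * of_nat k * hyp_coeff k m u w
       - of_nat (Suc k) * w * hyp_coeff (Suc k) m u w"

lemma hyp_coeff_0_right: "hyp_coeff k 0 u w = (w * u) ^ k"
  by (induction k) simp_all

lemma norm_hyp_factor_le:
  fixes w :: complex
  assumes "norm w \<le> W" "2 * real (Suc k) * W \<le> K"
  shows "norm (w * of_nat k) \<le> K / 2" "norm (of_nat (Suc k) * w) \<le> K / 2"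
proof -
  have "W \<ge> 0"
    using assms(1) norm_ge_zero order_trans by blast
  then have "norm w * real k \<le> W * real (Suc k)" "norm w * real (Suc k) \<le> W * real (Suc k)"
    using assms(1) by (intro mult_mono; simp)+
  moreover have "W * real (Suc k) \<le> K / 2"
    using assms(2) by (simp only: field_simps)
  ultimately show "norm (w * of_nat k) \<le> K / 2" "norm (of_nat (Suc k) * w) \<le> K / 2"
    by (simp_all only: norm_mult norm_of_nat mult.commute[of "real (Suc k)"])
qed

text \<open>With D = 2 W U + 1 the three terms of the recurrence contribute (D-1)/2, 1/2 and D/2
  times D^k K^(m+1), in total exactly D^(k+1) K^(m+1). Since K is only bounded below by 2 k W, one K
  serves all smaller k in the induction; K of order k then gives the growth D^k k^m.\<close>

lemma norm_hyp_coeff_le: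
  assumes "norm w \<le> W" "norm u \<le> U" "2 * real k * W \<le> K" "K > 0"
  shows "norm (hyp_coeff k m u w) \<le> (2 * W * U + 1) ^ k * K ^ m"
  using assms(3)
proof (induction k arbitrary: m)
  case 0
  then show ?case using assms by simp
next
  case (Suc k)
  define D where "D = 2 * W * U + 1"
  have W: "W \<ge> 0" and U: "U \<ge> 0"
    using assms norm_ge_zero order_trans by blast+
  then have D: "D \<ge> 1" "D \<ge> 0" "W * U = (D - 1) / 2"
    by (auto simp: D_def)
  have wu: "norm (w * u) \<le> (D - 1) / 2"
    using assms(1,2) W U unfolding D(3)[symmetric] norm_mult by (intro mult_mono) auto
  have kw: "norm (w * of_nat k) \<le> K / 2" "norm (of_nat (Suc k) * w) \<le> K / 2"
    using norm_hyp_factor_le[OF assms(1) Suc.prems] by auto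
  have k: "2 * real k * W \<le> K"
    using Suc.prems W by (simp add: algebra_simps)
  note IH = Suc.IH[OF k, folded D_def]
  have "norm (hyp_coeff (Suc k) m u w) \<le> D ^ Suc k * K ^ m"
  proof (induction m)
    case 0
    have "norm (w * u) * norm (hyp_coeff k 0 u w) \<le> D * D ^ k"
      using wu IH[of 0] D by (intro mult_mono) auto
    then show ?case by (simp add: norm_mult)
  next
    case (Suc m)
    have "norm (hyp_coeff (Suc k) (Suc m) u w) \<le> norm (w * u * hyp_coeff k (Suc m) u w)
        + norm (w * of_nat k * hyp_coeff k m u w) + norm (of_nat (Suc k) * w * hyp_coeff (Suc k) m u w)"
      unfolding hyp_coeff.simps
      by (rule order_trans[OF norm_triangle_ineq4]) (intro add_mono norm_triangle_ineq order_refl)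
    also have "\<dots> \<le> (D - 1) / 2 * (D ^ k * K ^ Suc m) + K / 2 * (D ^ k * K ^ m) + K / 2 * (D ^ Suc k * K ^ m)"
      unfolding norm_mult[of "w * u"] norm_mult[of "w * of_nat k"] norm_mult[of "of_nat (Suc k) * w"]
      using wu kw IH[of "Suc m"] IH[of m] Suc.IH D \<open>K > 0\<close>
      by (intro add_mono mult_mono) auto
    also have "\<dots> = D ^ Suc k * K ^ Suc m"
      by (simp add: field_simps)
    finally show ?case .
  qed
  then show ?case by (simp add: D_def)
qed

text \<open>The coefficients satisfy the functional equation of the products order by order, so
  truncation at N violates it by a single term in t^N.\<close>

lemma hyp_coeff_sum_step:
  assumes "N \<ge> 1"
  shows "(1 + of_nat (Suc k) * w * t) * (\<Sum>m<N. hyp_coeff (Suc k) m u w * t ^ m) =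
    w * (u + of_nat k * t) * (\<Sum>m<N. hyp_coeff k m u w * t ^ m)
      - (w * of_nat k * hyp_coeff k (N - 1) u w
           - of_nat (Suc k) * w * hyp_coeff (Suc k) (N - 1) u w) * t ^ N"
  using assms
proof (induction N rule: dec_induct)
  case base
  show ?case by (simp add: algebra_simps)
next
  case (step N)
  then obtain M where M: "N = Suc M" by (cases N) auto
  have "(1 + of_nat (Suc k) * w * t) * (\<Sum>m<Suc N. hyp_coeff (Suc k) m u w * t ^ m)
     = (1 + of_nat (Suc k) * w * t) * (\<Sum>m<N. hyp_coeff (Suc k) m u w * t ^ m)
     + (1 + of_nat (Suc k) * w * t) * hyp_coeff (Suc k) N u w * t ^ N"
    by (simp add: algebra_simps)
  then show ?case
    unfolding step.IH
    by (simp add: M algebra_simps)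
qed

text \<open>\<open>K * norm t \<le> 1\<close> keeps every denominator at modulus at least 1/2. The
  remainders obey the recurrence of the products up to one term in t^N: each step multiplies by at
  most D and adds at most 2 D^(k+1) (K |t|)^N, hence the factor 2 k.\<close>

lemma hyp_prod_remainder:
  assumes "norm w \<le> W" "norm u \<le> U" "2 * real k * W \<le> K" "K > 0" "K * norm t \<le> 1" "N \<ge> 1"
  shows "norm (hyp_prod k u w t - (\<Sum>m<N. hyp_coeff k m u w * t ^ m))
           \<le> 2 * real k * (2 * W * U + 1) ^ k * (K * norm t) ^ N"
  using assms(3)
proof (induction k)
  case 0
  have "(\<Sum>m<N. hyp_coeff 0 m u w * t ^ m) = (\<Sum>m<N. if m = 0 then 1 else 0)"
    by (intro sum.cong) auto
  then show ?case using assms(6) by (simp add: hyp_prod_def)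
next
  case (Suc k)
  define D where "D = 2 * W * U + 1"
  define R where "R k = hyp_prod k u w t - (\<Sum>m<N. hyp_coeff k m u w * t ^ m)" for k
  define q where "q = 1 + of_nat (Suc k) * w * t"
  have W: "W \<ge> 0" and U: "U \<ge> 0"
    using assms norm_ge_zero order_trans by blast+
  then have D: "D \<ge> 1" "D \<ge> 0" "W * U = (D - 1) / 2"
    by (auto simp: D_def)
  have wu: "norm (w * u) \<le> (D - 1) / 2"
    using assms(1,2) W U unfolding D(3)[symmetric] norm_mult by (intro mult_mono) auto
  have kw: "norm (w * of_nat k) \<le> K / 2" "norm (of_nat (Suc k) * w) \<le> K / 2"
    using norm_hyp_factor_le[OF assms(1) Suc.prems] by auto
  have k: "2 * real k * W \<le> K"
    using Suc.prems W by (simp add: algebra_simps)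
  note IH = Suc.IH[OF k, folded D_def R_def]
  have "norm (of_nat (Suc k) * w * t) \<le> K / 2 * norm t"
    unfolding norm_mult[of "of_nat (Suc k) * w"] by (intro mult_right_mono kw) auto
  then have "norm (of_nat (Suc k) * w * t) \<le> 1 / 2"
    using assms(5) by simp
  then have q: "norm q \<ge> 1 / 2"
    unfolding q_def using norm_diff_ineq[of 1 "of_nat (Suc k) * w * t"] by simp
  then have q0: "q \<noteq> 0" by auto
  have prod: "q * hyp_prod (Suc k) u w t = w * (u + of_nat k * t) * hyp_prod k u w t"
    using q0 by (simp add: hyp_prod_def q_def)
  have eq: "q * R (Suc k) = w * (u + of_nat k * t) * R k
      + (w * of_nat k * hyp_coeff k (N - 1) u w
           - of_nat (Suc k) * w * hyp_coeff (Suc k) (N - 1) u w) * t ^ N"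
    using hyp_coeff_sum_step[OF assms(6), of k w t u] prod
    unfolding R_def q_def[symmetric] by (simp add: algebra_simps)
  have wukt: "norm (w * (u + of_nat k * t)) \<le> D / 2"
  proof -
    have "norm (w * (u + of_nat k * t)) \<le> norm (w * u) + norm (w * of_nat k * t)"
      using norm_triangle_ineq[of "w * u" "w * of_nat k * t"] by (simp add: algebra_simps)
    also have "norm (w * of_nat k * t) \<le> K / 2 * norm t"
      unfolding norm_mult[of "w * of_nat k"] by (intro mult_right_mono kw) auto
    finally show ?thesis using wu assms(5) by simp
  qed
  have KN: "K * K ^ (N - 1) = K ^ N"
    using assms(6) by (cases N) auto
  have coeff: "norm (w * of_nat k * hyp_coeff k (N - 1) u w
           - of_nat (Suc k) * w * hyp_coeff (Suc k) (N - 1) u w) \<le> D ^ Suc k * K ^ N"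
  proof -
    have "norm (w * of_nat k * hyp_coeff k (N - 1) u w
           - of_nat (Suc k) * w * hyp_coeff (Suc k) (N - 1) u w)
        \<le> norm (w * of_nat k) * norm (hyp_coeff k (N - 1) u w)
         + norm (of_nat (Suc k) * w) * norm (hyp_coeff (Suc k) (N - 1) u w)"
      unfolding norm_mult[symmetric] by (rule norm_triangle_ineq4)
    also have "\<dots> \<le> K / 2 * (D ^ k * K ^ (N - 1)) + K / 2 * (D ^ Suc k * K ^ (N - 1))"
      unfolding D_def
      using assms kw k Suc.prems by (intro add_mono mult_mono norm_hyp_coeff_le) auto
    also have "\<dots> \<le> K / 2 * (D ^ Suc k * K ^ (N - 1)) + K / 2 * (D ^ Suc k * K ^ (N - 1))"
      using D \<open>K > 0\<close> by (intro add_mono mult_left_mono mult_right_mono power_increasing) auto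
    also have "\<dots> = D ^ Suc k * K ^ N"
      unfolding KN[symmetric] by simp
    finally show ?thesis .
  qed
  have "1 / 2 * norm (R (Suc k)) \<le> norm q * norm (R (Suc k))"
    using q by (intro mult_right_mono) auto
  also have "\<dots> = norm (q * R (Suc k))" by (simp add: norm_mult)
  also have "\<dots> \<le> norm (w * (u + of_nat k * t)) * norm (R k) +
     norm (w * of_nat k * hyp_coeff k (N - 1) u w
           - of_nat (Suc k) * w * hyp_coeff (Suc k) (N - 1) u w) * norm t ^ N"
    unfolding eq by (rule order_trans[OF norm_triangle_ineq]) (simp add: norm_mult norm_power)
  also have "\<dots> \<le> D / 2 * (2 * real k * D ^ k * (K * norm t) ^ N) + D ^ Suc k * K ^ N * norm t ^ N"
    using wukt IH coeff D \<open>K > 0\<close> by (intro add_mono mult_mono) auto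
  also have "\<dots> = 1 / 2 * (2 * real (Suc k) * D ^ Suc k * (K * norm t) ^ N)"
    by (simp add: field_simps power_mult_distrib)
  finally show ?case
    unfolding D_def R_def by simp
qed

section \<open>Factorials against exponentials and powers\<close>

lemma power_le_fact_mult_exp:
  fixes x :: real
  assumes "x \<ge> 0"
  shows "x ^ N \<le> fact N * exp x"
proof -
  have "(\<Sum>n\<in>{N}. x ^ n /\<^sub>R fact n) \<le> exp x"
    unfolding exp_def using assms summable_exp_generic[of x] by (intro sum_le_suminf) auto
  then show ?thesis by (simp add: field_simps)
qed

lemma summable_power_poly_over_fact:
  fixes C :: real
  assumes "C \<ge> 0"
  shows "summable (\<lambda>k. C ^ k * real (Suc k) ^ N / fact k)"
proof (rule summable_comparison_test')
  show "summable (\<lambda>k. fact N * exp 1 * ((C * exp 1) ^ k / fact k))"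
    using summable_exp_generic[of "C * exp 1"]
    by (intro summable_mult) (simp add: field_simps)
  fix k :: nat
  have "real (Suc k) ^ N \<le> fact N * exp (real (Suc k))"
    by (rule power_le_fact_mult_exp) simp
  also have "exp (real (Suc k)) = exp 1 ^ Suc k"
    using exp_of_nat_mult[of "Suc k" "1::real"] by (simp only: mult_1_right)
  finally have "C ^ k * real (Suc k) ^ N \<le> C ^ k * (fact N * exp 1 ^ Suc k)"
    using assms by (intro mult_left_mono) auto
  then have "C ^ k * real (Suc k) ^ N / fact k \<le> C ^ k * (fact N * exp 1 ^ Suc k) / fact k"
    by (intro divide_right_mono) auto
  then show "norm (C ^ k * real (Suc k) ^ N / fact k) \<le> fact N * exp 1 * ((C * exp 1) ^ k / fact k)"
    using assms by (simp add: power_mult_distrib mult_ac del: of_nat_Suc)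
qed

text \<open>With G = F e and q = n div L one has G^n <= G^L (G^L)^q and (G^L)^q <= q! exp(G^L). The
  factorial of a fixed fraction of n is needed because below only about n/L factors of a product are
  known to be large.\<close>

lemma power_poly_le_fact_div:
  fixes F :: real
  assumes "F \<ge> 1" "L \<ge> 1"
  shows "\<exists>C>0. \<forall>n. F ^ n * real (Suc n) ^ N \<le> C * fact (n div L)"
proof (intro exI[of _ "fact N * exp 1 * ((F * exp 1) ^ L * exp ((F * exp 1) ^ L))"] conjI allI)
  fix n
  define G where "G = F * exp 1"
  have G: "G \<ge> 1"
    using mult_mono[of 1 F 1 "exp 1 :: real"] assms(1) by (simp add: G_def)
  have "real (Suc n) ^ N \<le> fact N * exp (real (Suc n))"
    by (rule power_le_fact_mult_exp) simp
  also have "exp (real (Suc n)) = exp 1 ^ Suc n"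
    using exp_of_nat_mult[of "Suc n" "1::real"] by (simp only: mult_1_right)
  finally have "F ^ n * real (Suc n) ^ N \<le> F ^ n * (fact N * exp 1 ^ Suc n)"
    using assms by (intro mult_left_mono) auto
  also have "\<dots> = fact N * exp 1 * G ^ n"
    by (simp add: G_def power_mult_distrib mult_ac)
  also have "G ^ n \<le> G ^ (L * (n div L) + L)"
  proof (intro power_increasing G)
    show "n \<le> L * (n div L) + L"
      using assms(2) mult_div_mod_eq[of L n] mod_less_divisor[of L n] by linarith
  qed
  also have "\<dots> = (G ^ L) ^ (n div L) * G ^ L"
    by (simp add: power_add power_mult)
  also have "(G ^ L) ^ (n div L) \<le> fact (n div L) * exp (G ^ L)"
    using G by (intro power_le_fact_mult_exp) auto
  finally show "F ^ n * real (Suc n) ^ N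
      \<le> fact N * exp 1 * ((F * exp 1) ^ L * exp ((F * exp 1) ^ L)) * fact (n div L)"
    using G unfolding G_def[symmetric] by (simp add: mult_ac)
qed (use assms in auto)

section \<open>Coefficient functions and termwise expansion of the series\<close>

definition hyp_expansion :: "real \<Rightarrow> nat \<Rightarrow> complex \<Rightarrow> complex \<Rightarrow> complex" where
  "hyp_expansion a m u w = (\<Sum>k. of_real a ^ k / fact k * hyp_coeff k m u w)"

lemma norm_hyp_expansion_term_le:
  assumes "a > 0" "norm w \<le> W" "norm u \<le> U" "W > 0"
  shows "norm (of_real a ^ k / fact k * hyp_coeff k m u w)
           \<le> (2 * W) ^ m * ((a * (2 * W * U + 1)) ^ k * real (Suc k) ^ m / fact k)"
proof -
  \<comment> \<open>K is taken as 2 (k+1) W, which is positive also for k = 0.\<close>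
  have "norm (hyp_coeff k m u w) \<le> (2 * W * U + 1) ^ k * (2 * real (Suc k) * W) ^ m"
    using assms by (intro norm_hyp_coeff_le) auto
  then have "a ^ k / fact k * norm (hyp_coeff k m u w)
     \<le> a ^ k / fact k * ((2 * W * U + 1) ^ k * (2 * real (Suc k) * W) ^ m)"
    using assms by (intro mult_left_mono) auto
  then show ?thesis
    using assms by (simp add: norm_mult norm_divide norm_power power_mult_distrib mult_ac del: of_nat_Suc)
qed

lemma summable_hyp_expansion:
  assumes "a > 0"
  shows "summable (\<lambda>k. of_real a ^ k / fact k * hyp_coeff k m u w)"
proof (rule summable_comparison_test')
  show "summable (\<lambda>k. (2 * (norm w + 1)) ^ m *
      ((a * (2 * (norm w + 1) * norm u + 1)) ^ k * real (Suc k) ^ m / fact k))"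
    using assms by (intro summable_mult summable_power_poly_over_fact) (auto intro!: mult_nonneg_nonneg)
  show "norm (of_real a ^ k / fact k * hyp_coeff k m u w) \<le> (2 * (norm w + 1)) ^ m *
      ((a * (2 * (norm w + 1) * norm u + 1)) ^ k * real (Suc k) ^ m / fact k)" for k
    using assms by (intro norm_hyp_expansion_term_le) (auto intro: add_nonneg_pos)
qed

lemma hyp_expansion_0: "hyp_expansion a 0 u w = exp (of_real a * (w * u))"
  unfolding hyp_expansion_def exp_def hyp_coeff_0_right
  by (simp add: scaleR_conv_of_real power_mult_distrib field_simps)

text \<open>Weierstrass' theorem with a real majorant near each point. The majorant is controlled
  only for large k, so its absolute value is used to have nonnegative terms throughout.\<close>

lemma holomorphic_on_suminf_dominated:
  assumes S: "open S" and hol: "\<And>k. f k holomorphic_on S"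
    and dom: "\<And>x. x \<in> S \<Longrightarrow> \<exists>d h. 0 < d \<and> summable h \<and>
           (\<forall>\<^sub>F k in sequentially. \<forall>y\<in>ball x d \<inter> S. norm (f k y) \<le> (h k :: real))"
  shows "(\<lambda>x. \<Sum>k. f k x :: complex) holomorphic_on S"
    and "x \<in> S \<Longrightarrow> summable (\<lambda>k. f k x)"
proof -
  have dom': "\<exists>d h. 0 < d \<and> summable h \<and> range h \<subseteq> \<real>\<^sub>\<ge>\<^sub>0 \<and>
      (\<forall>\<^sub>F k in sequentially. \<forall>y\<in>ball x d \<inter> S. cmod (f k y) \<le> cmod (h k))" if x: "x \<in> S" for x
  proof -
    obtain d h where d: "d > 0" "summable h"
      and ev: "\<forall>\<^sub>F k in sequentially. \<forall>y\<in>ball x d \<inter> S. norm (f k y) \<le> (h k :: real)"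
      using dom[OF x] by blast
    have ev0: "\<forall>\<^sub>F k in sequentially. \<bar>h k\<bar> = h k"
      using ev
    proof eventually_elim
      case (elim k)
      have "0 \<le> norm (f k x)" by simp
      also have "\<dots> \<le> h k" using elim x d by simp
      finally show ?case by simp
    qed
    have "summable (\<lambda>k. \<bar>h k\<bar>)"
      using d(2) by (simp add: summable_cong[OF ev0])
    then have "summable (\<lambda>k. complex_of_real \<bar>h k\<bar>)"
      by (rule summable_of_real)
    moreover have "\<forall>\<^sub>F k in sequentially. \<forall>y\<in>ball x d \<inter> S. cmod (f k y) \<le> cmod (complex_of_real \<bar>h k\<bar>)"
      using ev by eventually_elim (auto intro: order_trans[OF _ abs_ge_self])
    ultimately show ?thesis
      using d(1) by (intro exI[of _ d] exI[of _ "\<lambda>k. complex_of_real \<bar>h k\<bar>"]) auto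
  qed
  have fd: "f n field_differentiable (at x)" if "x \<in> S" for n x
    using S hol[of n] that holomorphic_on_imp_differentiable_at by blast
  obtain g where g: "\<forall>x\<in>S. (\<lambda>n. f n x) sums g x \<and> g field_differentiable (at x)"
    by (rule series_differentiable_comparison_complex[OF S fd dom'])
  then have "g holomorphic_on S"
    by (auto simp: holomorphic_on_def field_differentiable_at_within)
  then show "(\<lambda>x. \<Sum>k. f k x) holomorphic_on S"
    by (rule holomorphic_transform) (use g sums_unique in blast)
  show "x \<in> S \<Longrightarrow> summable (\<lambda>k. f k x)"
    using g sums_summable by blast
qed

lemma holomorphic_on_hyp_coeff:
  assumes "u holomorphic_on S" "w holomorphic_on S"
  shows "(\<lambda>y. hyp_coeff k m (u y) (w y)) holomorphic_on S"
proof (induction k arbitrary: m)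
  case 0
  then show ?case by simp
next
  case (Suc k)
  note IH = Suc.IH
  show ?case
  proof (induction m)
    case 0
    show ?case
      unfolding hyp_coeff.simps by (intro holomorphic_intros assms IH)
  next
    case (Suc m)
    show ?case
      unfolding hyp_coeff.simps by (intro holomorphic_intros assms IH Suc.IH)
  qed
qed

lemma holomorphic_on_hyp_expansion:
  assumes "a > 0" "u holomorphic_on - {1}"
  shows "(\<lambda>y. hyp_expansion a m (u y) (1 / (1 - y))) holomorphic_on - {1}"
  unfolding hyp_expansion_def
proof (rule holomorphic_on_suminf_dominated)
  show "(\<lambda>y. of_real a ^ k / fact k * hyp_coeff k m (u y) (1 / (1 - y))) holomorphic_on - {1}" for k
    by (intro holomorphic_intros holomorphic_on_hyp_coeff assms) auto
next
  fix y0 :: complex assume y0: "y0 \<in> - {1}"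
  \<comment> \<open>Half the distance to the singular point 1, so that 1/(1-y) is bounded by 1/d on
    the closed ball.\<close>
  define d where "d = norm (1 - y0) / 2"
  define W where "W = 1 / d"
  have d: "d > 0" and W: "W > 0"
    using y0 by (auto simp: d_def W_def)
  have dist: "norm (1 - y) \<ge> d" if "y \<in> cball y0 d" for y
    using that norm_triangle_ineq[of "1 - y" "y - y0"]
    by (auto simp: d_def dist_norm norm_minus_commute)
  have "cball y0 d \<subseteq> - {1}"
    using dist d by force
  then have "compact (u ` cball y0 d)"
    by (intro compact_continuous_image holomorphic_on_imp_continuous_on
        holomorphic_on_subset[OF assms(2)]) auto
  then obtain U where U: "\<And>y. y \<in> cball y0 d \<Longrightarrow> norm (u y) \<le> U"
    by (meson bounded_iff compact_imp_bounded image_eqI)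
  have "U \<ge> 0"
    using order_trans[OF norm_ge_zero U[of y0]] d by simp
  then have "summable (\<lambda>k. (2 * W) ^ m * ((a * (2 * W * U + 1)) ^ k * real (Suc k) ^ m / fact k))"
    using assms W by (intro summable_mult summable_power_poly_over_fact) auto
  moreover have "norm (of_real a ^ k / fact k * hyp_coeff k m (u y) (1 / (1 - y)))
      \<le> (2 * W) ^ m * ((a * (2 * W * U + 1)) ^ k * real (Suc k) ^ m / fact k)"
    if "y \<in> ball y0 d" for y k
  proof (intro norm_hyp_expansion_term_le assms W U)
    show "norm (1 / (1 - y)) \<le> W"
      using dist[of y] that d by (auto simp: W_def norm_divide intro!: divide_left_mono mult_pos_pos)
  qed (use that in auto)
  ultimately show "\<exists>d h. 0 < d \<and> summable h \<and> (\<forall>\<^sub>F k in sequentially. \<forall>y\<in>ball y0 d \<inter> - {1}.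
      norm (of_real a ^ k / fact k * hyp_coeff k m (u y) (1 / (1 - y))) \<le> h k)"
    using d by (intro exI[of _ d] exI[of _ "\<lambda>k. (2 * W) ^ m * ((a * (2 * W * U + 1)) ^ k * real (Suc k) ^ m / fact k)"]
        conjI always_eventually allI ballI) auto
qed auto

text \<open>The sum is split at 2 (k+1) W = n. Below, the Taylor remainder of each product applies.
  Above, the Taylor polynomial weighted by a^k/k! is itself of order n^(-N), and the product is left
  to a hypothesis with majorant \<open>L\<close>: denominators may come close to zero there, and the
  two applications control them for different reasons.\<close>

lemma hyp_series_expansion:
  assumes a: "a > 0" and W: "W > 0" and U: "U \<ge> 0" and N: "N \<ge> 1" and L: "summable L"
    and L0: "\<And>k. L k \<ge> 0"
  shows "\<exists>M. \<forall>n\<ge>1. \<forall>u w t. norm u \<le> U \<and> norm w \<le> W \<and> norm t = 1 / real n \<and>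
     (\<forall>k. real n < 2 * real (Suc k) * W \<longrightarrow>
        norm (of_real a ^ k / fact k * hyp_prod k u w t) \<le> L k / real n ^ N) \<longrightarrow>
     summable (\<lambda>k. of_real a ^ k / fact k * hyp_prod k u w t) \<and>
     norm ((\<Sum>k. of_real a ^ k / fact k * hyp_prod k u w t) - (\<Sum>m<N. hyp_expansion a m u w * t ^ m))
       \<le> M / real n ^ N"
proof -
  define D where "D = 2 * W * U + 1"
  have D: "D \<ge> 1" using W U by (simp add: D_def)
  define K where "K k = 2 * real (Suc k) * W" for k
  have K: "K k > 0" for k using W by (simp add: K_def)
  define c where "c k = (of_real a ^ k / fact k :: complex)" for k
  have c: "norm (c k) = a ^ k / fact k" for k
    using a by (simp add: c_def norm_divide norm_power)
  \<comment> \<open>The factor N + 2 covers both ranges: 2 from the Taylor remainder for small k, N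
    from the number of terms of the Taylor polynomial for large k.\<close>
  define E where "E k = (real N + 2) * (2 * W) ^ N * ((a * D) ^ k * real (Suc k) ^ (N + 1) / fact k)" for k
  define B where "B k = E k + L k" for k
  have E: "norm (c k) * (r * real (Suc k) * D ^ k * K k ^ N) \<le> E k" if "0 \<le> r" "r \<le> real N + 2" for k r
  proof -
    have "norm (c k) * (r * real (Suc k) * D ^ k * K k ^ N)
        \<le> norm (c k) * ((real N + 2) * real (Suc k) * D ^ k * K k ^ N)"
      using that D K[of k] by (intro mult_left_mono mult_right_mono) auto
    also have "\<dots> = E k"
      by (simp add: E_def c K_def power_mult_distrib mult_ac del: of_nat_Suc)
    finally show ?thesis .
  qed
  have E0: "E k \<ge> 0" for k
    using a D W by (auto simp: E_def)
  have B: "summable B"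
    unfolding B_def E_def using a D
    by (intro summable_add L summable_mult summable_power_poly_over_fact) auto
  have *: "summable (\<lambda>k. c k * hyp_prod k u w t) \<and>
     norm ((\<Sum>k. c k * hyp_prod k u w t) - (\<Sum>m<N. hyp_expansion a m u w * t ^ m))
       \<le> suminf B / real n ^ N"
    if n: "n \<ge> 1" and u: "norm u \<le> U" and w: "norm w \<le> W" and t: "norm t = 1 / real n"
      and tail: "\<And>k. real n < K k \<Longrightarrow> norm (c k * hyp_prod k u w t) \<le> L k / real n ^ N" for n u w t
  proof -
    define A where "A k = (\<Sum>m<N. hyp_coeff k m u w * t ^ m)" for k
    define d where "d k = c k * hyp_prod k u w t - c k * A k" for k
    have d: "norm (d k) \<le> B k / real n ^ N" for k
    proof (cases "real n < K k")
      case False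
      then have "K k * norm t \<le> 1"
        using n by (simp add: t field_simps)
      have "norm (d k) = norm (c k) * norm (hyp_prod k u w t - A k)"
        by (simp add: d_def norm_mult[symmetric] algebra_simps)
      also have "\<dots> \<le> norm (c k) * (2 * real k * D ^ k * (K k * norm t) ^ N)"
        unfolding A_def D_def using w u \<open>K k * norm t \<le> 1\<close> W K N
        by (intro mult_left_mono hyp_prod_remainder) (auto simp: K_def)
      also have "\<dots> \<le> norm (c k) * (2 * real (Suc k) * D ^ k * (K k * norm t) ^ N)"
        using D K[of k] by (intro mult_left_mono mult_right_mono) auto
      also have "\<dots> = norm (c k) * (2 * real (Suc k) * D ^ k * K k ^ N) / real n ^ N"
        by (simp add: t power_divide del: of_nat_Suc)
      also have "\<dots> \<le> B k / real n ^ N"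
        using E[of 2 k] L0[of k] by (intro divide_right_mono) (auto simp: B_def simp del: of_nat_Suc)
      finally show ?thesis .
    next
      case True
      \<comment> \<open>In this range every power (K |t|)^m with m < N may be raised to (K |t|)^N,
        which is where the factor n^(-N) comes from.\<close>
      have Kt: "K k * norm t \<ge> 1"
        using n True by (simp add: t field_simps)
      have "norm (A k) \<le> (\<Sum>m<N. norm (hyp_coeff k m u w * t ^ m))"
        unfolding A_def by (rule norm_sum)
      also have "\<dots> \<le> (\<Sum>m<N. D ^ k * (K k * norm t) ^ N)"
      proof (rule sum_mono)
        fix m assume m: "m \<in> {..<N}"
        have "norm (hyp_coeff k m u w * t ^ m) \<le> D ^ k * K k ^ m * norm t ^ m"
          unfolding norm_mult norm_power D_def using w u K W
          by (intro mult_right_mono norm_hyp_coeff_le) (auto simp: K_def)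
        also have "\<dots> = D ^ k * (K k * norm t) ^ m"
          by (simp add: power_mult_distrib)
        also have "\<dots> \<le> D ^ k * (K k * norm t) ^ N"
          using m D Kt by (intro mult_left_mono power_increasing) auto
        finally show "norm (hyp_coeff k m u w * t ^ m) \<le> D ^ k * (K k * norm t) ^ N" .
      qed
      also have "\<dots> = real N * D ^ k * K k ^ N / real n ^ N"
        by (simp add: t power_divide)
      finally have "norm (c k) * norm (A k) \<le> norm (c k) * (real N * D ^ k * K k ^ N / real n ^ N)"
        by (intro mult_left_mono) auto
      also have "\<dots> \<le> norm (c k) * (real N * real (Suc k) * D ^ k * K k ^ N / real n ^ N)"
        using D K[of k] mult_left_mono[of 1 "real (Suc k)" "real N"]
        by (intro mult_left_mono divide_right_mono mult_right_mono) auto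
      also have "\<dots> = norm (c k) * (real N * real (Suc k) * D ^ k * K k ^ N) / real n ^ N"
        by simp
      also have "\<dots> \<le> E k / real n ^ N"
        by (intro divide_right_mono E) auto
      finally have "norm (c k) * norm (A k) \<le> E k / real n ^ N" .
      moreover have "norm (d k) \<le> norm (c k * hyp_prod k u w t) + norm (c k) * norm (A k)"
        unfolding d_def norm_mult[symmetric] by (rule norm_triangle_ineq4)
      ultimately show ?thesis
        using tail[OF True] by (simp add: B_def add_divide_distrib)
    qed
    have "summable (\<lambda>k. B k / real n ^ N)"
      using B by (rule summable_divide)
    then have ds: "summable d" "norm (suminf d) \<le> (\<Sum>k. B k / real n ^ N)"
      using d by (blast intro: summable_comparison_test' norm_suminf_le)+
    have As: "(\<lambda>k. c k * A k) sums (\<Sum>m<N. hyp_expansion a m u w * t ^ m)"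
    proof -
      have "(\<lambda>k. \<Sum>m<N. c k * hyp_coeff k m u w * t ^ m) sums (\<Sum>m<N. hyp_expansion a m u w * t ^ m)"
        unfolding hyp_expansion_def c_def
        by (intro sums_sum sums_mult2 summable_sums summable_hyp_expansion a)
      then show ?thesis
        by (simp add: A_def sum_distrib_left mult_ac)
    qed
    have "(\<lambda>k. d k + c k * A k) sums (suminf d + (\<Sum>m<N. hyp_expansion a m u w * t ^ m))"
      by (intro sums_add summable_sums ds As)
    then have s: "(\<lambda>k. c k * hyp_prod k u w t) sums (suminf d + (\<Sum>m<N. hyp_expansion a m u w * t ^ m))"
      by (simp add: d_def)
    show ?thesis
      using ds(2) sums_summable[OF s] sums_unique[OF s, symmetric] suminf_divide[OF B, of "real n ^ N"]
      by simp
  qed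
  show ?thesis
    unfolding c_def[symmetric] K_def[symmetric]
    by (intro exI[of _ "suminf B"] allI impI, elim conjE, intro *) auto
qed

section \<open>The Charlier polynomials and the Kummer series\<close>

text \<open>The factor with index n has numerator 1 - n/n = 0; this is why the series for the
  Charlier polynomial terminates.\<close>

lemma hyp_prod_eq_0:
  assumes "n \<ge> 1" "n < k"
  shows "hyp_prod k 1 w (- 1 / of_nat n) = 0"
proof -
  have "\<exists>j\<in>{..<k}. w * (1 + of_nat j * (- 1 / of_nat n)) / (1 + of_nat (Suc j) * w * (- 1 / of_nat n)) = 0"
    using assms by (intro bexI[of _ n]) auto
  then show ?thesis
    unfolding hyp_prod_def by (subst prod_zero_iff) auto
qed

text \<open>For these parameters the j-th factor is (n-j)/(n-j-1-x). The numerators build up k!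
  binom(n,k), and the denominators are the last k factors of (-x)_n.\<close>

lemma hyp_prod_eq_binomial:
  fixes n :: nat and y :: complex
  defines "x \<equiv> of_nat n * y"
  assumes n: "n \<ge> 1" and y: "y \<noteq> 1" and y': "\<And>j. j < n \<Longrightarrow> x \<noteq> of_nat j" and "k \<le> n"
  shows "pochhammer (- x) (n - k) * (fact k * of_nat (n choose k)) =
           pochhammer (- x) n * hyp_prod k 1 (1 / (1 - y)) (- 1 / of_nat n)"
proof -
  define h where "h k = hyp_prod k 1 (1 / (1 - y)) (- 1 / of_nat n)" for k
  have n0: "of_nat n \<noteq> (0::complex)" using n by simp
  have h_Suc: "h (Suc k) = h k * (of_nat (n - k) / (of_nat (n - Suc k) - x))" if "Suc k \<le> n" for k
  proof -
    have "(1 / (1 - y) * (1 + of_nat k * (- 1 / of_nat n))) /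
        (1 + of_nat (Suc k) * (1 / (1 - y)) * (- 1 / of_nat n))
      = (of_nat n - of_nat k) / (of_nat n * (1 - y) - of_nat (Suc k))"
    proof -
      have "1 + of_nat (Suc k) * (1 / (1 - y)) * (- 1 / of_nat n)
          = (of_nat n * (1 - y) - of_nat (Suc k)) / (of_nat n * (1 - y))"
        using n0 y by (simp add: divide_simps del: of_nat_Suc)
      moreover have "1 / (1 - y) * (1 + of_nat k * (- 1 / of_nat n)) = (of_nat n - of_nat k) / (of_nat n * (1 - y))"
        using n0 y by (simp add: divide_simps)
      ultimately show ?thesis
        using n0 y by simp
    qed
    also have "of_nat n * (1 - y) - of_nat (Suc k) = of_nat (n - Suc k) - x"
      using that by (simp add: x_def of_nat_diff algebra_simps del: of_nat_Suc)
    also have "of_nat n - of_nat k = (of_nat (n - k) :: complex)"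
      using that by (simp add: of_nat_diff)
    finally show ?thesis
      by (simp add: h_def hyp_prod_def)
  qed
  have "pochhammer (- x) (n - k) * (fact k * of_nat (n choose k)) = pochhammer (- x) n * h k"
    using \<open>k \<le> n\<close>
  proof (induction k)
    case 0
    show ?case by (simp add: h_def hyp_prod_def)
  next
    case (Suc k)
    have nk: "n - k = Suc (n - Suc k)" using Suc.prems by simp
    have ne: "of_nat (n - Suc k) - x \<noteq> 0"
      using y'[of "n - Suc k"] n by auto
    have "fact (Suc k) * (n choose Suc k) = fact k * (Suc k * (n choose Suc k))"
      by (simp add: algebra_simps)
    also have "Suc k * (n choose Suc k) = (n - k) * (n choose k)"
      using binomial_absorption[of k "n"] binomial_absorb_comp[of n k] Suc.prems
      by (metis Suc_diff_Suc Suc_le_lessD binomial_absorption diff_Suc_1 mult.commute times_binomial_minus1_eq zero_less_Suc)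
    finally have b: "(fact (Suc k) * of_nat (n choose Suc k) :: complex)
        = fact k * (of_nat (n - k) * of_nat (n choose k))"
      by (metis of_nat_fact of_nat_mult)
    have "pochhammer (- x) (n - k) * (fact k * of_nat (n choose k)) = pochhammer (- x) n * h k"
      using Suc by simp
    then have IH: "pochhammer (- x) (n - Suc k) * (of_nat (n - Suc k) - x) * (fact k * of_nat (n choose k))
        = pochhammer (- x) n * h k"
      unfolding nk pochhammer_Suc by simp
    show ?case
      unfolding b h_Suc[OF Suc.prems] mult.assoc[symmetric] IH[symmetric]
      using ne by simp
  qed
  then show ?thesis
    by (simp add: h_def)
qed

text \<open>Reversing the summation produces (-x)_(n-k) up to sign, from which (-x)_n can be
  factored out. Only the nodes below n are excluded, as these are the zeros of (-x)_n.\<close>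

lemma charlier_eq_hyp_series:
  assumes n: "n \<ge> 1" and y: "y \<noteq> 1" and y': "\<And>j. j < n \<Longrightarrow> of_nat n * y \<noteq> of_nat j"
  shows "charlier a n (of_nat n * y) = (-1) ^ n * pochhammer (- (of_nat n * y)) n *
           (\<Sum>k. of_real a ^ k / fact k * hyp_prod k 1 (1 / (1 - y)) (- 1 / of_nat n))"
proof -
  define x where "x = of_nat n * y"
  define h where "h k = hyp_prod k 1 (1 / (1 - y)) (- 1 / of_nat n)" for k
  have n0: "of_nat n \<noteq> (0::complex)" using n by simp
  have poch: "pochhammer (- x) (n - k) * (fact k * of_nat (n choose k)) = pochhammer (- x) n * h k"
    if "k \<le> n" for k
    unfolding h_def x_def using assms that by (intro hyp_prod_eq_binomial)
  have h0: "h k = 0" if "k \<notin> {..n}" for k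
    unfolding h_def using n that by (intro hyp_prod_eq_0) auto
  have "charlier a n x = (\<Sum>k\<le>n. of_nat (n choose (n - k)) * (x gchoose (n - k)) * fact (n - k) * (- of_real a) ^ k)"
    unfolding charlier_def by (rule sum.reindex_bij_witness[of _ "\<lambda>k. n - k" "\<lambda>k. n - k"]) auto
  also have "\<dots> = (\<Sum>k\<le>n. (-1) ^ n * pochhammer (- x) n * (of_real a ^ k / fact k * h k))"
  proof (rule sum.cong[OF refl])
    fix k assume k: "k \<in> {..n}"
    have "(x gchoose (n - k)) * fact (n - k) = (-1) ^ (n - k) * pochhammer (- x) (n - k)"
      by (simp add: gbinomial_pochhammer)
    then have "of_nat (n choose (n - k)) * (x gchoose (n - k)) * fact (n - k) * (- of_real a) ^ k
        = of_nat (n choose k) * ((-1) ^ (n - k) * pochhammer (- x) (n - k)) * ((-1) ^ k * of_real a ^ k)"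
      using k binomial_symmetric[of k n] by (simp add: power_minus[of "of_real a"] mult.assoc)
    also have "\<dots> = ((-1) ^ (n - k) * (-1) ^ k) * of_real a ^ k / fact k
        * (pochhammer (- x) (n - k) * (fact k * of_nat (n choose k)))"
      by simp
    also have "(-1) ^ (n - k) * (-1) ^ k = ((-1) ^ n :: complex)"
      using k by (simp flip: power_add)
    also have "pochhammer (- x) (n - k) * (fact k * of_nat (n choose k)) = pochhammer (- x) n * h k"
      using poch[of k] k by simp
    finally show "of_nat (n choose (n - k)) * (x gchoose (n - k)) * fact (n - k) * (- of_real a) ^ k
        = (-1) ^ n * pochhammer (- x) n * (of_real a ^ k / fact k * h k)"
      by simp
  qed
  also have "\<dots> = (-1) ^ n * pochhammer (- x) n * (\<Sum>k\<le>n. of_real a ^ k / fact k * h k)"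
    by (rule sum_distrib_left[symmetric])
  also have "(\<Sum>k\<le>n. of_real a ^ k / fact k * h k) = (\<Sum>k. of_real a ^ k / fact k * h k)"
    by (rule suminf_finite[symmetric]) (use h0 in auto)
  finally show ?thesis
    by (simp add: h_def x_def)
qed

section \<open>Bounds for Pochhammer products and reciprocal Gamma values\<close>

lemma norm_pochhammer_ge:
  fixes z :: complex
  assumes "0 \<le> c" "c \<le> 1" "c \<le> Re z"
  shows "c ^ k * fact k \<le> norm (pochhammer z k)"
proof (induction k)
  case (Suc k)
  have "c * real (Suc k) = c + c * real k"
    by (simp add: algebra_simps)
  also have "\<dots> \<le> Re z + real k"
    using assms mult_right_mono[of c 1 "real k"] by simp
  also have "\<dots> \<le> norm (z + of_nat k)"
    using complex_Re_le_cmod[of "z + of_nat k"] by simp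
  finally have "(c ^ k * fact k) * (c * real (Suc k)) \<le> norm (pochhammer z k) * norm (z + of_nat k)"
    using Suc assms by (intro mult_mono) auto
  then show ?case
    by (simp add: pochhammer_Suc norm_mult mult_ac)
qed simp

lemma norm_pochhammer_le:
  fixes z :: complex
  assumes "norm z \<le> R"
  shows "norm (pochhammer z k) \<le> (R + 1) ^ k * fact k"
proof (induction k)
  case (Suc k)
  have R: "R \<ge> 0" using assms norm_ge_zero order_trans by blast
  have "norm (z + of_nat k) \<le> R + real k"
    using assms norm_triangle_ineq[of z "of_nat k"] by simp
  also have "\<dots> \<le> (R + 1) * real (Suc k)"
    using R by (simp add: algebra_simps)
  finally have "norm (pochhammer z k) * norm (z + of_nat k) \<le> ((R + 1) ^ k * fact k) * ((R + 1) * real (Suc k))"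
    using Suc R by (intro mult_mono) auto
  then show ?case
    by (simp add: pochhammer_Suc norm_mult mult_ac)
qed simp

text \<open>1/Gamma(z) = (z)_k / Gamma(z+k), and |(z)_k| >= k! in the half-plane Re z >= 1.\<close>

lemma norm_rGamma_shift_le:
  fixes z :: complex
  assumes "Re z \<ge> 1"
  shows "norm (rGamma (z + of_nat k)) \<le> norm (rGamma z) / fact k"
proof -
  have "fact k * norm (rGamma (z + of_nat k)) \<le> norm (pochhammer z k) * norm (rGamma (z + of_nat k))"
    using norm_pochhammer_ge[of 1 z k] assms by (intro mult_right_mono) auto
  also have "\<dots> = norm (rGamma z)"
    by (metis norm_mult pochhammer_rGamma)
  finally show ?thesis
    by (simp add: field_simps)
qed

section \<open>The regularized Kummer series and its recurrence in n\<close>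

definition kummer_term :: "real \<Rightarrow> nat \<Rightarrow> nat \<Rightarrow> complex \<Rightarrow> complex" where
  "kummer_term a n k x =
     pochhammer (- x) k / fact k * of_real a ^ k * rGamma (of_nat n + 1 - x + of_nat k)"

text \<open>Kummer's function M(-x, n+1-x, a) divided by Gamma(n+1-x). With \<open>rGamma\<close>
  inside the terms each of them is entire in x, also where n+1-x is a pole of Gamma.\<close>

definition kummer_series :: "real \<Rightarrow> nat \<Rightarrow> complex \<Rightarrow> complex" where
  "kummer_series a n x = (\<Sum>k. kummer_term a n k x)"

definition subdominant :: "real \<Rightarrow> nat \<Rightarrow> complex \<Rightarrow> complex" where
  "subdominant a n x = (- of_real a) ^ n * fact n * kummer_series a n x"

lemma holomorphic_on_pochhammer [holomorphic_intros]:
  "f holomorphic_on S \<Longrightarrow> (\<lambda>z. pochhammer (f z) n) holomorphic_on S"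
  by (induction n) (auto simp: pochhammer_Suc intro!: holomorphic_intros)

text \<open>(-y)_k/k! may grow exponentially in k, so the decay has to come from 1/Gamma. It sets in
  once the argument has real part at least 1, which the shift by \<open>p\<close> guarantees on the
  whole ball; from there on it is of order 1/(k-p)!.\<close>

lemma kummer_term_dominated:
  assumes "a > 0"
  shows "\<exists>d h. 0 < d \<and> summable h \<and>
           (\<forall>\<^sub>F k in sequentially. \<forall>y\<in>ball x d \<inter> UNIV. norm (kummer_term a n k y) \<le> (h k :: real))"
proof -
  define R where "R = norm x + 1"
  define p where "p = nat \<lceil>R\<rceil>"
  have R: "R \<ge> 1" "R \<le> real p"
    using real_nat_ceiling_ge[of R] by (simp_all add: R_def p_def)
  have "compact ((\<lambda>y. rGamma (of_nat n + 1 - y + of_nat p)) ` cball x 1)"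
    by (intro compact_continuous_image holomorphic_on_imp_continuous_on) (auto intro!: holomorphic_intros)
  then obtain B where B: "\<And>y. y \<in> cball x 1 \<Longrightarrow> norm (rGamma (of_nat n + 1 - y + of_nat p)) \<le> B"
    by (meson bounded_iff compact_imp_bounded image_eqI)
  define h where "h k = ((R + 1) * a) ^ k * B / fact (k - p)" for k
  have "summable (\<lambda>i. ((R + 1) * a) ^ p * B * (((R + 1) * a) ^ i / fact i))"
    using summable_exp_generic[of "(R + 1) * a"]
    by (intro summable_mult) (simp add: field_simps)
  then have "summable (\<lambda>i. h (i + p))"
    by (simp add: h_def power_add mult_ac)
  then have h: "summable h"
    by (simp only: summable_iff_shift)
  have "norm (kummer_term a n k y) \<le> h k" if k: "k \<ge> p" and y: "y \<in> ball x 1" for k y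
  proof -
    define z where "z = of_nat n + 1 - y + of_nat p"
    have ny: "norm y \<le> R"
      using y norm_triangle_ineq[of x "y - x"] by (auto simp: R_def dist_norm norm_minus_commute)
    then have "Re y \<le> real p"
      using R complex_Re_le_cmod[of y] by linarith
    then have z: "Re z \<ge> 1"
      by (simp add: z_def)
    have "norm (rGamma (of_nat n + 1 - y + of_nat k)) = norm (rGamma (z + of_nat (k - p)))"
      using k by (simp add: z_def of_nat_diff algebra_simps)
    also have "\<dots> \<le> norm (rGamma z) / fact (k - p)"
      by (rule norm_rGamma_shift_le[OF z])
    also have "\<dots> \<le> B / fact (k - p)"
      using B[of y] y by (intro divide_right_mono) (auto simp: z_def)
    finally have 1: "norm (rGamma (of_nat n + 1 - y + of_nat k)) \<le> B / fact (k - p)" .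
    have 2: "norm (pochhammer (- y) k / fact k * of_real a ^ k) \<le> (R + 1) ^ k * a ^ k"
      using norm_pochhammer_le[of "- y" R k] ny assms
      by (auto simp: norm_mult norm_divide norm_power field_simps intro!: mult_right_mono)
    have "norm (kummer_term a n k y) \<le> (R + 1) ^ k * a ^ k * (B / fact (k - p))"
      unfolding kummer_term_def norm_mult[of "pochhammer (- y) k / fact k * of_real a ^ k"]
      using 1 2 assms R by (intro mult_mono) auto
    then show ?thesis
      by (simp add: h_def power_mult_distrib)
  qed
  then show ?thesis
    using h by (intro exI[of _ 1] exI[of _ h])
      (auto simp: eventually_sequentially intro!: exI[of _ p])
qed

lemma
  assumes "a > 0"
  shows holomorphic_on_kummer_series: "kummer_series a n holomorphic_on S"
    and summable_kummer_term: "summable (\<lambda>k. kummer_term a n k x)"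
proof -
  have hol: "kummer_term a n k holomorphic_on UNIV" for k
    unfolding kummer_term_def by (intro holomorphic_intros) auto
  have "kummer_series a n holomorphic_on UNIV"
    unfolding kummer_series_def[abs_def]
    using open_UNIV hol kummer_term_dominated[OF assms] by (rule holomorphic_on_suminf_dominated)
  then show "kummer_series a n holomorphic_on S"
    by (rule holomorphic_on_subset) auto
  show "summable (\<lambda>k. kummer_term a n k x)"
    using open_UNIV hol kummer_term_dominated[OF assms] UNIV_I by (rule holomorphic_on_suminf_dominated)
qed

lemma holomorphic_on_subdominant:
  "a > 0 \<Longrightarrow> subdominant a n holomorphic_on S"
  unfolding subdominant_def[abs_def] by (intro holomorphic_intros holomorphic_on_kummer_series)

text \<open>A contiguous relation, obtained termwise. With v n k the k-th term, v (n-1) k = (n-x+k)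
  v n k, and the factor k is removed by (k+1) v n (k+1) = a v n k - a (n+1) v (n+1) k.\<close>

lemma kummer_series_recurrence:
  assumes "a > 0" "n \<ge> 1"
  shows "kummer_series a (n - 1) x =
    (of_nat n - x + of_real a) * kummer_series a n x - of_real a * of_nat (Suc n) * kummer_series a (Suc n) x"
proof -
  define v where "v n k = kummer_term a n k x" for n k
  have v: "v m sums kummer_series a m x" for m
    unfolding v_def kummer_series_def using summable_kummer_term[OF assms(1)] by (rule summable_sums)
  obtain m where m: "n = Suc m" using assms(2) by (cases n) auto
  have 1: "v m k = (of_nat n - x) * v n k + of_nat k * v n k" for k
  proof -
    define c where "c = pochhammer (- x) k / fact k * of_real a ^ k"
    have "v m k = c * rGamma (of_nat n - x + of_nat k)"
      by (simp add: v_def kummer_term_def c_def m add_ac)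
    also have "\<dots> = c * ((of_nat n - x + of_nat k) * rGamma (of_nat n - x + of_nat k + 1))"
      by (simp only: rGamma_plus1)
    finally have A: "v m k = c * ((of_nat n - x + of_nat k) * rGamma (of_nat n - x + of_nat k + 1))" .
    have B: "v n k = c * rGamma (of_nat n - x + of_nat k + 1)"
      by (simp add: v_def kummer_term_def c_def algebra_simps)
    show ?thesis
      unfolding A B by (simp only: algebra_simps)
  qed
  have 2: "of_nat (Suc k) * v n (Suc k) = of_real a * v n k - of_real a * of_nat (Suc n) * v (Suc n) k" for k
  proof -
    define r where "r = rGamma (of_nat n + 2 - x + of_nat k)"
    define c where "c = pochhammer (- x) k / fact k * of_real a ^ k"
    have "of_nat (Suc k) * v n (Suc k)
        = of_nat (Suc k) * (pochhammer (- x) k * (of_nat k - x) / (of_nat (Suc k) * fact k)) * (of_real a * of_real a ^ k)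
          * rGamma (of_nat n + 1 - x + of_nat (Suc k))"
      by (simp add: v_def kummer_term_def pochhammer_Suc)
    also have "of_nat n + 1 - x + of_nat (Suc k) = of_nat n + 2 - x + of_nat k"
      by simp
    also have "of_nat (Suc k) * (pochhammer (- x) k * (of_nat k - x) / (of_nat (Suc k) * fact k))
        = (of_nat k - x) * (pochhammer (- x) k / fact k)"
      by (simp del: of_nat_Suc)
    also have "(of_nat k - x) * (pochhammer (- x) k / fact k) * (of_real a * of_real a ^ k)
        * rGamma (of_nat n + 2 - x + of_nat k) = of_real a * (of_nat k - x) * c * r"
      by (simp add: r_def c_def)
    finally have A: "of_nat (Suc k) * v n (Suc k) = of_real a * (of_nat k - x) * c * r" .
    have "rGamma (of_nat n + 1 - x + of_nat k) = (of_nat n + 1 - x + of_nat k) * r"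
      using rGamma_plus1[of "of_nat n + 1 - x + of_nat k"] by (simp add: r_def algebra_simps)
    then have B: "v n k = (of_nat n + 1 - x + of_nat k) * c * r"
      by (simp add: v_def kummer_term_def c_def)
    have C: "v (Suc n) k = c * r"
      by (simp add: v_def kummer_term_def c_def r_def algebra_simps)
    show ?thesis
      unfolding A B C by (simp add: algebra_simps)
  qed
  have "(\<lambda>k. of_real a * v n k - of_real a * of_nat (Suc n) * v (Suc n) k) sums
      (of_real a * kummer_series a n x - of_real a * of_nat (Suc n) * kummer_series a (Suc n) x)"
    by (intro sums_diff sums_mult v)
  then have "(\<lambda>k. of_nat (Suc k) * v n (Suc k)) sums
      (of_real a * kummer_series a n x - of_real a * of_nat (Suc n) * kummer_series a (Suc n) x)"
    by (simp only: 2)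
  \<comment> \<open>The index shift adds only the term k = 0, which carries the factor 0.\<close>
  then have "(\<lambda>k. of_nat k * v n k) sums
      (of_real a * kummer_series a n x - of_real a * of_nat (Suc n) * kummer_series a (Suc n) x)"
    by (subst (asm) sums_Suc_iff) simp
  then have "(\<lambda>k. (of_nat n - x) * v n k + of_nat k * v n k) sums ((of_nat n - x) * kummer_series a n x +
      (of_real a * kummer_series a n x - of_real a * of_nat (Suc n) * kummer_series a (Suc n) x))"
    by (intro sums_add sums_mult v)
  then have "v m sums ((of_nat n - x) * kummer_series a n x +
      (of_real a * kummer_series a n x - of_real a * of_nat (Suc n) * kummer_series a (Suc n) x))"
    by (simp only: 1[symmetric])
  then show ?thesis
    using sums_unique2[OF v[of m]] by (simp add: m algebra_simps)
qed

lemma charlier_rec_subdominant: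
  assumes "a > 0"
  shows "charlier_rec a (subdominant a)"
  unfolding charlier_rec_def
proof (intro allI impI)
  fix n :: nat and x assume n: "n \<ge> 1"
  then obtain m where m: "n = Suc m" by (cases n) auto
  have *: "kummer_series a m x =
    (of_nat n - x + of_real a) * kummer_series a n x - of_real a * of_nat (Suc n) * kummer_series a (Suc n) x"
    using kummer_series_recurrence[OF assms n] by (simp add: m)
  have n1: "n - 1 = m" by (simp add: m)
  have f: "fact n = of_nat n * (fact m :: complex)" "fact (Suc n) = of_nat (Suc n) * (of_nat n * (fact m :: complex))"
    by (simp_all add: m)
  have p: "(- of_real a) ^ n = - of_real a * (- of_real a :: complex) ^ m"
    "(- of_real a) ^ Suc n = of_real a * (of_real a * (- of_real a :: complex) ^ m)"
    by (simp_all add: m)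
  show "x * subdominant a n x = subdominant a (Suc n) x + (of_nat n + of_real a) * subdominant a n x
      + of_real a * of_nat n * subdominant a (n - 1) x"
    unfolding subdominant_def n1 f p * by (simp only: ring_distribs) (simp add: mult_ac)
qed

section \<open>Values at the nodes and the duality of the Charlier polynomials\<close>

lemma fact_mult_rGamma:
  "fact n * rGamma (of_nat n + 1 - of_nat j) = (fact j * of_nat (n choose j) :: complex)"
proof (cases "j \<le> n")
  case True
  have "rGamma (of_nat n + 1 - of_nat j) = inverse (Gamma (1 + of_nat (n - j)) :: complex)"
    using True by (simp add: rGamma_inverse_Gamma of_nat_diff algebra_simps)
  also have "\<dots> = inverse (fact (n - j))"
    by (simp only: Gamma_fact)
  finally show ?thesis
    using True by (simp add: binomial_fact field_simps)
next
  case False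
  \<comment> \<open>Both sides vanish: 1/Gamma is zero at the nonpositive integer n+1-j, and
    binom(n,j) = 0.\<close>
  have "of_nat n + 1 - of_nat j = - (of_nat (j - Suc n) :: complex)"
    using False by (simp add: of_nat_diff)
  then have "rGamma (of_nat n + 1 - of_nat j :: complex) = 0"
    by (simp only: rGamma_eq_zero_iff minus_of_nat_in_nonpos_Ints)
  then show ?thesis
    using False by simp
qed

text \<open>At x = m the Kummer series stops at k = m. With b = -a and j = m-k both sides are the
  sum of binom(m,j) binom(n,j) j! b^(n-j), which is symmetric in m and n up to a power of b: the
  self-duality of the Charlier polynomials.\<close>

lemma charlier_of_nat:
  assumes "a > 0"
  shows "charlier a n (of_nat m) = inverse ((- of_real a) ^ m) * subdominant a n (of_nat m)"
proof -
  define b where "b = (- of_real a :: complex)"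
  have b: "b \<noteq> 0" using assms by (simp add: b_def)
  define f where "f j = of_nat (m choose j) * of_nat (n choose j) * fact j * b ^ n / b ^ j" for j
  have kt: "fact n * b ^ n * kummer_term a n k (of_nat m) = b ^ m * f (m - k)" if "k \<in> {..m}" for k
  proof -
    have k: "k \<le> m" using that by simp
    have "pochhammer (- of_nat m) k / fact k * of_real a ^ k = b ^ k * of_nat (m choose k)"
      using gbinomial_pochhammer[of "of_nat m :: complex" k]
      by (simp add: binomial_gbinomial b_def power_minus[of "of_real a"])
    then have "fact n * b ^ n * kummer_term a n k (of_nat m) = b ^ n * b ^ k * of_nat (m choose k) *
        (fact n * rGamma (of_nat n + 1 - of_nat (m - k)))"
      using k by (simp add: kummer_term_def of_nat_diff algebra_simps)
    also have "b ^ k = b ^ m / b ^ (m - k)"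
      using k b by (simp add: power_diff)
    finally show ?thesis
      unfolding fact_mult_rGamma f_def using k binomial_symmetric[of k m] by simp
  qed
  have "kummer_term a n k (of_nat m) = 0" if "k \<notin> {..m}" for k
    using that by (simp add: kummer_term_def pochhammer_of_nat_eq_0_iff)
  then have "kummer_series a n (of_nat m) = (\<Sum>k\<le>m. kummer_term a n k (of_nat m))"
    unfolding kummer_series_def by (intro suminf_finite) auto
  then have "subdominant a n (of_nat m) = (\<Sum>k\<le>m. fact n * b ^ n * kummer_term a n k (of_nat m))"
    by (simp add: subdominant_def b_def sum_distrib_left mult_ac)
  also have "\<dots> = (\<Sum>k\<le>m. b ^ m * f (m - k))"
    by (intro sum.cong refl kt)
  also have "\<dots> = (\<Sum>j\<le>m. b ^ m * f j)"
    by (rule sum.reindex_bij_witness[of _ "\<lambda>k. m - k" "\<lambda>k. m - k"]) auto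
  \<comment> \<open>The summands vanish for j > m and for j > n, so the range j <= m passes to j <=
    n by way of j <= n + m.\<close>
  also have "\<dots> = b ^ m * (\<Sum>j\<le>n + m. f j)"
    unfolding sum_distrib_left by (rule sum.mono_neutral_left) (auto simp: f_def)
  also have "(\<Sum>j\<le>n + m. f j) = (\<Sum>j\<le>n. f j)"
    by (rule sum.mono_neutral_right) (auto simp: f_def)
  also have "\<dots> = charlier a n (of_nat m)"
    unfolding charlier_def f_def b_def[symmetric]
    by (intro sum.cong) (auto simp: binomial_gbinomial[symmetric] power_diff b)
  finally show ?thesis
    using b by (simp add: b_def)
qed

section \<open>Uniform expansions away from the nodes\<close>

lemma norm_pochhammer_ge_power:
  fixes z :: complex
  assumes "0 \<le> c" "\<And>i. i < k \<Longrightarrow> c \<le> norm (z + of_nat i)"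
  shows "c ^ k \<le> norm (pochhammer z k)"
  using assms(2)
proof (induction k)
  case (Suc k)
  then show ?case
    using assms(1) mult_mono[of "c ^ k" "norm (pochhammer z k)" c "norm (z + of_nat k)"]
    by (simp add: pochhammer_Suc norm_mult mult_ac)
qed simp

text \<open>The sign appears because the products are evaluated at t = -1/n.\<close>

definition charlier_coeff :: "real \<Rightarrow> nat \<Rightarrow> complex \<Rightarrow> complex" where
  "charlier_coeff a m y = (-1) ^ m * hyp_expansion a m 1 (1 / (1 - y))"

lemma charlier_coeff_0: "charlier_coeff a 0 y = exp (of_real a / (1 - y))"
  by (simp add: charlier_coeff_def hyp_expansion_0)

lemma holomorphic_on_charlier_coeff:
  "a > 0 \<Longrightarrow> charlier_coeff a m holomorphic_on - {1}"
  unfolding charlier_coeff_def[abs_def]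
  by (intro holomorphic_intros holomorphic_on_hyp_expansion) auto

text \<open>The product is k! binom(n,k) divided by \<open>p\<close>, the last k factors of (-x)_n.
  The final q = n div L of them have modulus at least n \<delta> - q >= q and contribute q!; the
  others have modulus at least 1/2. Together with binom(n,k) <= 2^n this yields the base 4.\<close>

lemma norm_hyp_prod_tail_le:
  assumes a: "a > 0" and \<delta>: "\<delta> > 0" and L: "L \<ge> 1" "2 / \<delta> \<le> real L" and n: "n \<ge> 1"
    and y: "\<delta> \<le> norm (1 - y)" and y': "\<And>j. j < n \<Longrightarrow> 1 / 2 \<le> norm (of_nat n * y - of_nat j)"
    and k: "n div L \<le> k" "k \<le> n"
  shows "norm (of_real a ^ k / fact k * hyp_prod k 1 (1 / (1 - y)) (- 1 / of_nat n))
           \<le> (4 * max 1 a) ^ n / fact (n div L)"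
proof -
  define x where "x = of_nat n * y"
  define q where "q = n div L"
  define p where "p = pochhammer (of_nat (n - k) - x) k"
  define h where "h = hyp_prod k 1 (1 / (1 - y)) (- 1 / of_nat n)"
  have y1: "y \<noteq> 1" using y \<delta> by auto
  have xj: "1 / 2 \<le> norm (of_nat j - x)" if "j < n" for j
    using y'[OF that] by (simp add: x_def norm_minus_commute)
  then have ne: "x \<noteq> of_nat j" if "j < n" for j
    using that by fastforce
  have "pochhammer (- x) (n - k) * (fact k * of_nat (n choose k)) = pochhammer (- x) n * h"
    unfolding h_def x_def using n y1 ne k(2) by (intro hyp_prod_eq_binomial) (auto simp: x_def)
  also have "pochhammer (- x) n = pochhammer (- x) (n - k) * p"
    using pochhammer_product[of "n - k" n "- x"] k by (simp add: p_def)
  finally have "pochhammer (- x) (n - k) * (fact k * of_nat (n choose k)) = pochhammer (- x) (n - k) * (p * h)"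
    by simp
  moreover have "pochhammer (- x) (n - k) \<noteq> 0"
    using ne n by (auto simp: pochhammer_eq_0_iff)
  ultimately have ph: "p * h = fact k * of_nat (n choose k)"
    by simp
  have qL: "real q \<le> real n / real L"
    unfolding q_def by (rule of_nat_div_le_of_nat)
  have nL: "real n / real L \<le> real n * \<delta> / 2"
    using L \<delta> mult_right_mono[OF L(2), of "real n"] by (simp add: field_simps)
  have "(1 / 2) ^ (k - q) \<le> norm (pochhammer (of_nat (n - k) - x) (k - q))"
  proof (rule norm_pochhammer_ge_power)
    fix i assume "i < k - q"
    then show "1 / 2 \<le> norm (of_nat (n - k) - x + of_nat i)"
      using xj[of "n - k + i"] k by (simp add: algebra_simps)
  qed simp
  moreover have "(1 / 2 :: real) ^ n \<le> (1 / 2) ^ (k - q)"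
    using k by (intro power_decreasing) auto
  moreover have "real q ^ q \<le> norm (pochhammer (of_nat (n - k) - x + of_nat (k - q)) q)"
  proof (rule norm_pochhammer_ge_power)
    fix i assume i: "i < q"
    have "of_nat (n - k) - x + of_nat (k - q) + of_nat i = of_nat n * (1 - y) - of_nat (q - i)"
      using k i by (simp add: x_def q_def of_nat_diff algebra_simps)
    also have "norm \<dots> \<ge> norm (of_nat n * (1 - y)) - norm (of_nat (q - i) :: complex)"
      by (rule norm_triangle_ineq2)
    finally have "real n * norm (1 - y) - real (q - i) \<le> norm (of_nat (n - k) - x + of_nat (k - q) + of_nat i)"
      by (simp add: norm_mult)
    moreover have "real n * norm (1 - y) \<ge> real n * \<delta>"
      using y by (intro mult_left_mono) auto
    ultimately show "real q \<le> norm (of_nat (n - k) - x + of_nat (k - q) + of_nat i)"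
      using qL nL of_nat_diff[OF less_imp_le[OF i], where ?'a = real] by linarith
  qed simp
  moreover have "fact q \<le> real q ^ q"
    using fact_le_power[of q, where ?'a = real] by simp
  moreover have "p = pochhammer (of_nat (n - k) - x) (k - q) * pochhammer (of_nat (n - k) - x + of_nat (k - q)) q"
  proof -
    have "k - (k - q) = q" "k - q \<le> k" using k by (auto simp: q_def)
    then show ?thesis
      using pochhammer_product[of "k - q" k "of_nat (n - k) - x"] by (simp only: p_def)
  qed
  ultimately have p: "(1 / 2) ^ n * fact q \<le> norm p"
    by (simp only: norm_mult) (intro mult_mono; linarith?; simp)
  then have p0: "norm p > 0"
    by (rule less_le_trans[rotated]) simp
  have "a ^ k \<le> max 1 a ^ n"
    using a k by (intro order_trans[OF power_mono power_increasing]) auto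
  moreover have "real (n choose k) \<le> 2 ^ n"
    using of_nat_mono[OF binomial_le_pow2[of n k], where ?'a = real] by simp
  ultimately have ab: "a ^ k * real (n choose k) \<le> max 1 a ^ n * 2 ^ n"
    by (intro mult_mono) auto
  have "norm h = fact k * real (n choose k) / norm p"
    using arg_cong[OF ph, of norm] p0 by (simp add: norm_mult field_simps)
  then have "norm (of_real a ^ k / fact k * h) = a ^ k * real (n choose k) / norm p"
    using a by (simp add: norm_mult norm_divide norm_power)
  also have "\<dots> \<le> max 1 a ^ n * 2 ^ n / ((1 / 2) ^ n * fact q)"
    using ab p p0 by (intro frac_le) auto
  also have "\<dots> = (4 * max 1 a) ^ n / fact q"
  proof -
    have "(4 * max 1 a) ^ n = max 1 a ^ n * 2 ^ n * 2 ^ n"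
      unfolding power_mult_distrib[symmetric] by simp
    then show ?thesis by (simp only:) (simp add: power_divide)
  qed
  finally show ?thesis
    by (simp add: h_def q_def)
qed

lemma charlier_expansion:
  assumes a: "a > 0" and \<delta>: "\<delta> > 0" and N: "N \<ge> 1"
  shows "\<exists>M. \<forall>n\<ge>1. \<forall>y. \<delta> \<le> norm (1 - y) \<and> (\<forall>j<n. 1 / 2 \<le> norm (of_nat n * y - of_nat j)) \<longrightarrow>
     (\<exists>s. charlier a n (of_nat n * y) = (-1) ^ n * pochhammer (- (of_nat n * y)) n * s \<and>
        norm (s - (\<Sum>m<N. charlier_coeff a m y / of_nat n ^ m)) \<le> M / real n ^ N)"
proof -
  \<comment> \<open>2/\<delta> <= L serves twice: n/L <= n \<delta>/2 in the tail bound, and n < 2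
    (k+1)/\<delta> forces n div L <= k.\<close>
  define L where "L = nat \<lceil>2 / \<delta>\<rceil> + 1"
  have L: "L \<ge> 1" "2 / \<delta> \<le> real L"
    unfolding L_def by (simp, linarith)
  \<comment> \<open>Base 8 instead of 4: the spare 2^n leaves a factor (1/2)^n <= (1/2)^k for k <=
    n, hence a summable tail.\<close>
  obtain C where C: "C > 0" "\<And>n. (8 * max 1 a) ^ n * real (Suc n) ^ N \<le> C * fact (n div L)"
    using power_poly_le_fact_div[of "8 * max 1 a" L N] L(1) by fastforce
  have sm: "summable (\<lambda>k. C * (1 / 2) ^ k)"
    by (intro summable_mult summable_geometric) auto
  have "0 < 1 / \<delta>" "0 \<le> C * (1 / 2) ^ k" for k
    using \<delta> C(1) by auto
  from hyp_series_expansion[OF a this(1) zero_le_one N sm this(2)]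
  obtain M where "\<forall>n\<ge>1. \<forall>u w t. norm u \<le> 1 \<and> norm w \<le> 1 / \<delta> \<and> norm t = 1 / real n \<and>
     (\<forall>k. real n < 2 * real (Suc k) * (1 / \<delta>) \<longrightarrow>
        norm (of_real a ^ k / fact k * hyp_prod k u w t) \<le> C * (1 / 2) ^ k / real n ^ N) \<longrightarrow>
     summable (\<lambda>k. of_real a ^ k / fact k * hyp_prod k u w t) \<and>
     norm ((\<Sum>k. of_real a ^ k / fact k * hyp_prod k u w t) - (\<Sum>m<N. hyp_expansion a m u w * t ^ m))
       \<le> M / real n ^ N" ..
  note M = this[rule_format]
  show ?thesis
  proof (intro exI[of _ M] allI impI, elim conjE)
    fix n :: nat and y :: complex
    assume n: "n \<ge> 1" and y: "\<delta> \<le> norm (1 - y)" and y': "\<forall>j<n. 1 / 2 \<le> norm (of_nat n * y - of_nat j)"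
    define h where "h k = hyp_prod k 1 (1 / (1 - y)) (- 1 / of_nat n)" for k
    have y1: "y \<noteq> 1" using y \<delta> by auto
    have tail: "norm (of_real a ^ k / fact k * h k) \<le> C * (1 / 2) ^ k / real n ^ N"
      if k: "real n < 2 * real (Suc k) * (1 / \<delta>)" for k
    proof (cases "k \<le> n")
      case False
      then show ?thesis
        using n C(1) hyp_prod_eq_0[of n k] by (simp add: h_def)
    next
      case True
      have "real (n div L) \<le> real n / real L"
        by (rule of_nat_div_le_of_nat)
      also have "\<dots> < real (Suc k)"
      proof -
        have "real n < real (Suc k) * (2 / \<delta>)" using k by (simp add: field_simps)
        also have "\<dots> \<le> real (Suc k) * real L" using L by (intro mult_left_mono) auto
        finally show ?thesis using L by (simp add: field_simps)
      qed
      finally have "n div L \<le> k" by simp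
      then have "norm (of_real a ^ k / fact k * h k) \<le> (4 * max 1 a) ^ n / fact (n div L)"
        unfolding h_def using a \<delta> L n y y' True by (intro norm_hyp_prod_tail_le) auto
      also have "\<dots> \<le> C * (1 / 2) ^ n / real (Suc n) ^ N"
      proof -
        define X where "X = (4 * max 1 a) ^ n"
        define Y where "Y = real (Suc n) ^ N"
        have "(8 * max 1 a) ^ n = 2 ^ n * X"
          unfolding X_def power_mult_distrib[symmetric] by simp
        then have "2 ^ n * X * Y \<le> C * fact (n div L)"
          using C(2)[of n] by (simp only: Y_def)
        moreover have "Y > 0" by (simp add: Y_def)
        ultimately have "X / fact (n div L) \<le> C * (1 / 2) ^ n / Y"
          by (simp add: field_simps power_divide)
        then show ?thesis
          by (simp only: X_def Y_def)
      qed
      also have "\<dots> \<le> C * (1 / 2) ^ k / real n ^ N"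
        using C(1) True n by (intro frac_le mult_left_mono power_decreasing power_mono) auto
      finally show ?thesis .
    qed
    have w: "norm (1 / (1 - y)) \<le> 1 / \<delta>"
      using y \<delta> by (simp add: norm_divide frac_le)
    have "norm ((\<Sum>k. of_real a ^ k / fact k * h k)
        - (\<Sum>m<N. hyp_expansion a m 1 (1 / (1 - y)) * (- 1 / of_nat n) ^ m)) \<le> M / real n ^ N"
      unfolding h_def using w n tail by (intro M[THEN conjunct2]) (auto simp: h_def norm_divide)
    moreover have "hyp_expansion a m 1 (1 / (1 - y)) * (- 1 / of_nat n) ^ m = charlier_coeff a m y / of_nat n ^ m" for m
      using power_minus[of "1 / of_nat n :: complex" m] by (simp add: charlier_coeff_def power_divide)
    moreover have "charlier a n (of_nat n * y) = (-1) ^ n * pochhammer (- (of_nat n * y)) n *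
        (\<Sum>k. of_real a ^ k / fact k * h k)"
      unfolding h_def
    proof (rule charlier_eq_hyp_series[OF n y1])
      show "of_nat n * y \<noteq> of_nat j" if "j < n" for j
      proof
        assume "of_nat n * y = of_nat j"
        then have "norm (of_nat n * y - of_nat j) = 0" by simp
        with y' that show False by fastforce
      qed
    qed
    ultimately show "\<exists>s. charlier a n (of_nat n * y) = (-1) ^ n * pochhammer (- (of_nat n * y)) n * s \<and>
        norm (s - (\<Sum>m<N. charlier_coeff a m y / of_nat n ^ m)) \<le> M / real n ^ N"
      by auto
  qed
qed

section \<open>The Kummer series for Re y < 1 and on circles around the nodes\<close>

lemma kummer_term_eq_hyp_prod:
  assumes n: "n \<ge> 1" and y: "Re y < 1"
  shows "kummer_term a n k (of_nat n * y) = rGamma (of_nat n + 1 - of_nat n * y) *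
           (of_real a ^ k / fact k * hyp_prod k (- y) (1 / (1 - y)) (1 / of_nat n))"
proof -
  define x where "x = of_nat n * y"
  define z where "z = of_nat n + 1 - x"
  have "real n * Re y \<le> real n * 1"
    using y by (intro mult_left_mono) auto
  then have Rez: "Re z \<ge> 1"
    by (simp add: z_def x_def)
  have p: "pochhammer z k \<noteq> 0"
  proof
    assume "pochhammer z k = 0"
    then have "fact k \<le> (0::real)"
      using norm_pochhammer_ge[of 1 z k] Rez by simp
    then show False
      using fact_gt_zero[of k, where ?'a = real] by linarith
  qed
  have zj: "z + of_nat j \<noteq> 0" for j
  proof
    assume "z + of_nat j = 0"
    then have "Re (z + of_nat j) = 0" by simp
    then show False using Rez by simp
  qed
  have y1: "y \<noteq> 1" using y by auto
  have "pochhammer (- x) k / pochhammer z k = (\<Prod>j<k. (- x + of_nat j) / (z + of_nat j))"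
    by (simp add: pochhammer_prod prod_dividef atLeast0LessThan)
  also have "\<dots> = hyp_prod k (- y) (1 / (1 - y)) (1 / of_nat n)"
    unfolding hyp_prod_def
  proof (rule prod.cong[OF refl])
    fix j
    have n0: "of_nat n \<noteq> (0::complex)" using n by simp
    have "1 + of_nat (Suc j) * (1 / (1 - y)) * (1 / of_nat n) = (z + of_nat j) / (of_nat n * (1 - y))"
      using n0 y1 by (simp add: z_def x_def field_simps)
    moreover have "1 / (1 - y) * (- y + of_nat j * (1 / of_nat n)) = (- x + of_nat j) / (of_nat n * (1 - y))"
      using n0 y1 by (simp add: x_def field_simps)
    ultimately show "(- x + of_nat j) / (z + of_nat j) = 1 / (1 - y) * (- y + of_nat j * (1 / of_nat n)) /
        (1 + of_nat (Suc j) * (1 / (1 - y)) * (1 / of_nat n))"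
      using n0 y1 zj[of j] by simp
  qed
  finally have "hyp_prod k (- y) (1 / (1 - y)) (1 / of_nat n) = pochhammer (- x) k / pochhammer z k" ..
  moreover have "rGamma (z + of_nat k) = rGamma z / pochhammer z k"
    using pochhammer_rGamma[of z k] p by simp
  ultimately show ?thesis
    by (simp add: kummer_term_def z_def x_def)
qed

text \<open>For t = 1/n the denominators move away from zero: with s = j/n each factor has modulus
  at most (2+s)/(c+s) <= 2/c. So the Kummer series has no critical tail, unlike the terminating
  series, where t = -1/n.\<close>

lemma norm_hyp_prod_le:
  assumes c: "0 < c" "c \<le> 1" "c \<le> Re (1 - y)" and y: "norm y \<le> 2" and n: "n \<ge> 1"
  shows "norm (hyp_prod k (- y) (1 / (1 - y)) (1 / of_nat n)) \<le> (2 / c) ^ k"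
proof -
  have y1: "y \<noteq> 1" using c by auto
  have "norm (hyp_prod k (- y) (1 / (1 - y)) (1 / of_nat n)) \<le> (\<Prod>j<k. 2 / c)"
    unfolding hyp_prod_def prod_norm[symmetric]
  proof (intro prod_mono conjI norm_ge_zero)
    fix j
    define s where "s = real j / real n"
    have s: "s \<ge> 0" by (simp add: s_def)
    have nu: "norm (- y + of_nat j * (1 / of_nat n)) \<le> 2 + s"
      using y norm_triangle_ineq[of "- y" "of_nat j * (1 / of_nat n)"]
      by (simp add: s_def norm_mult norm_divide)
    have "c + s \<le> Re (1 - y + of_nat (Suc j) / of_nat n)"
    proof -
      have "s \<le> real (Suc j) / real n"
        by (simp add: s_def divide_right_mono)
      moreover have "Re (of_nat (Suc j) / of_nat n) = real (Suc j) / real n"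
        by (metis Re_complex_of_real of_real_divide of_real_of_nat_eq)
      ultimately show ?thesis
        using c(3) by simp
    qed
    then have de: "c + s \<le> norm (1 - y + of_nat (Suc j) / of_nat n)"
      using complex_Re_le_cmod order_trans by blast
    have "1 / (1 - y) * (- y + of_nat j * (1 / of_nat n)) / (1 + of_nat (Suc j) * (1 / (1 - y)) * (1 / of_nat n))
        = (- y + of_nat j * (1 / of_nat n)) / (1 - y + of_nat (Suc j) / of_nat n)"
    proof -
      have "1 + of_nat (Suc j) * (1 / (1 - y)) * (1 / of_nat n) = (1 - y + of_nat (Suc j) / of_nat n) / (1 - y)"
        using y1 n by (simp add: add_divide_distrib mult.commute)
      then show ?thesis using y1 by simp
    qed
    also have "norm \<dots> \<le> (2 + s) / (c + s)"
      unfolding norm_divide using nu de c s by (intro frac_le) auto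
    also have "\<dots> \<le> 2 / c"
    proof -
      have "c * s \<le> 2 * s"
        using c s by (intro mult_right_mono) auto
      then show ?thesis
        using c s by (simp add: field_simps)
    qed
    finally show "norm (1 / (1 - y) * (- y + of_nat j * (1 / of_nat n)) /
        (1 + of_nat (Suc j) * (1 / (1 - y)) * (1 / of_nat n))) \<le> 2 / c" .
  qed
  then show ?thesis by simp
qed

lemma norm_hyp_prod_term_le:
  assumes "a > 0" "0 < c" "c \<le> 1" "c \<le> Re (1 - y)" "norm y \<le> 2" "n \<ge> 1"
  shows "norm (of_real a ^ k / fact k * hyp_prod k (- y) (1 / (1 - y)) (1 / of_nat n))
           \<le> (a * (2 / c)) ^ k / fact k"
proof -
  have "a ^ k / fact k * norm (hyp_prod k (- y) (1 / (1 - y)) (1 / of_nat n)) \<le> a ^ k / fact k * (2 / c) ^ k"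
    using assms by (intro mult_left_mono norm_hyp_prod_le) auto
  then show ?thesis
    using assms(1) by (simp only: norm_mult norm_divide norm_power power_mult_distrib norm_of_real norm_fact) simp
qed

lemma norm_kummer_series_le:
  assumes "a > 0" "0 < c" "c \<le> 1" "c \<le> Re (1 - y)" "norm y \<le> 2" "n \<ge> 1"
  shows "norm (kummer_series a n (of_nat n * y)) \<le> norm (rGamma (of_nat n + 1 - of_nat n * y)) * exp (a * (2 / c))"
proof -
  define R where "R = norm (rGamma (of_nat n + 1 - of_nat n * y))"
  have "Re y < 1" using assms by simp
  have e: "(\<lambda>k. R * ((a * (2 / c)) ^ k / fact k)) sums (R * exp (a * (2 / c)))"
    using exp_converges[of "a * (2 / c)"] by (intro sums_mult) (simp add: field_simps)
  have "norm (kummer_term a n k (of_nat n * y)) \<le> R * ((a * (2 / c)) ^ k / fact k)" for k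
    unfolding kummer_term_eq_hyp_prod[OF assms(6) \<open>Re y < 1\<close>] norm_mult[of "rGamma _"] R_def
    using assms by (intro mult_left_mono norm_hyp_prod_term_le) auto
  then show ?thesis
    unfolding kummer_series_def R_def[symmetric] sums_unique[OF e]
    by (rule norm_suminf_le) (use e in \<open>rule sums_summable\<close>)
qed

definition kummer_coeff :: "real \<Rightarrow> nat \<Rightarrow> complex \<Rightarrow> complex" where
  "kummer_coeff a m y = hyp_expansion a m (- y) (1 / (1 - y))"

lemma kummer_coeff_0: "kummer_coeff a 0 y = exp (- (of_real a * y / (1 - y)))"
  by (simp add: kummer_coeff_def hyp_expansion_0)

lemma holomorphic_on_kummer_coeff:
  "a > 0 \<Longrightarrow> kummer_coeff a m holomorphic_on - {1}"
  unfolding kummer_coeff_def[abs_def]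
  by (intro holomorphic_on_hyp_expansion holomorphic_intros)

lemma subdominant_expansion:
  assumes a: "a > 0" and \<rho>: "0 < \<rho>" "\<rho> < 1" and N: "N \<ge> 1"
  shows "\<exists>M. \<forall>n\<ge>1. \<forall>y. norm y \<le> \<rho> \<longrightarrow>
     (\<exists>s. subdominant a n (of_nat n * y) = subdominant_scale a n (of_nat n * y) * s \<and>
        norm (s - (\<Sum>m<N. kummer_coeff a m y / of_nat n ^ m)) \<le> M / real n ^ N)"
proof -
  define c where "c = 1 - \<rho>"
  have c: "0 < c" "c \<le> 1" using \<rho> by (auto simp: c_def)
  \<comment> \<open>In the tail n < 2 (k+1)/c, so the factor (2 (k+1)/c)^N / n^N is at least 1 and
    may be inserted into the bound for each term.\<close>
  define L where "L k = (2 / c) ^ N * ((a * (2 / c)) ^ k * real (Suc k) ^ N / fact k)" for k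
  have sm: "summable L"
    unfolding L_def using a c by (intro summable_mult summable_power_poly_over_fact) auto
  have "0 < 1 / c" "0 \<le> L k" for k
    using a c by (auto simp: L_def)
  from hyp_series_expansion[OF a this(1) zero_le_one N sm this(2)]
  obtain M where "\<forall>n\<ge>1. \<forall>u w t. norm u \<le> 1 \<and> norm w \<le> 1 / c \<and> norm t = 1 / real n \<and>
     (\<forall>k. real n < 2 * real (Suc k) * (1 / c) \<longrightarrow>
        norm (of_real a ^ k / fact k * hyp_prod k u w t) \<le> L k / real n ^ N) \<longrightarrow>
     summable (\<lambda>k. of_real a ^ k / fact k * hyp_prod k u w t) \<and>
     norm ((\<Sum>k. of_real a ^ k / fact k * hyp_prod k u w t) - (\<Sum>m<N. hyp_expansion a m u w * t ^ m))
       \<le> M / real n ^ N" ..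
  note M = this[rule_format]
  show ?thesis
  proof (intro exI[of _ M] allI impI)
    fix n :: nat and y :: complex
    assume n: "n \<ge> 1" and y: "norm y \<le> \<rho>"
    have Rey: "c \<le> Re (1 - y)" "Re y < 1"
      using complex_Re_le_cmod[of y] y \<rho> by (auto simp: c_def)
    have y2: "norm y \<le> 2" using y \<rho> by simp
    define h where "h k = hyp_prod k (- y) (1 / (1 - y)) (1 / of_nat n)" for k
    have tail: "norm (of_real a ^ k / fact k * h k) \<le> L k / real n ^ N"
      if k: "real n < 2 * real (Suc k) * (1 / c)" for k
    proof -
      have "real n ^ N \<le> (2 / c * real (Suc k)) ^ N"
        using k by (intro power_mono) auto
      then have "1 \<le> (2 / c * real (Suc k)) ^ N / real n ^ N"
        using n by simp
      then have "(a * (2 / c)) ^ k / fact k * 1 \<le> (a * (2 / c)) ^ k / fact k * ((2 / c * real (Suc k)) ^ N / real n ^ N)"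
        using a c by (intro mult_left_mono) auto
      also have "\<dots> = L k / real n ^ N"
        unfolding L_def power_mult_distrib[of "2 / c" "real (Suc k)"] by (simp del: of_nat_Suc)
      finally show ?thesis
        using norm_hyp_prod_term_le[OF a c Rey(1) y2 n, of k] by (simp add: h_def)
    qed
    have "1 - \<rho> \<le> norm (1 - y)"
      using Rey(1) complex_Re_le_cmod[of "1 - y"] by (simp add: c_def)
    then have w: "norm (1 / (1 - y)) \<le> 1 / c"
      using c by (simp add: norm_divide c_def frac_le)
    have *: "summable (\<lambda>k. of_real a ^ k / fact k * h k) \<and> norm ((\<Sum>k. of_real a ^ k / fact k * h k)
        - (\<Sum>m<N. hyp_expansion a m (- y) (1 / (1 - y)) * (1 / of_nat n) ^ m)) \<le> M / real n ^ N"
      unfolding h_def using w n tail y \<rho> by (intro M) (auto simp: h_def norm_divide)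
    moreover have "hyp_expansion a m (- y) (1 / (1 - y)) * (1 / of_nat n) ^ m = kummer_coeff a m y / of_nat n ^ m" for m
      by (simp add: kummer_coeff_def power_divide)
    moreover have "subdominant a n (of_nat n * y) = subdominant_scale a n (of_nat n * y) * (\<Sum>k. of_real a ^ k / fact k * h k)"
    proof -
      have "kummer_series a n (of_nat n * y) = rGamma (of_nat n + 1 - of_nat n * y) * (\<Sum>k. of_real a ^ k / fact k * h k)"
        unfolding kummer_series_def kummer_term_eq_hyp_prod[OF n Rey(2)] h_def[symmetric]
        using * by (intro suminf_mult) auto
      moreover have "Gamma (of_nat n + 1) = (fact n :: complex)"
        using Gamma_fact[of n] by (simp add: add_ac)
      ultimately show ?thesis
        by (simp add: subdominant_def subdominant_scale_def rGamma_inverse_Gamma divide_inverse algebra_simps)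
    qed
    ultimately show "\<exists>s. subdominant a n (of_nat n * y) = subdominant_scale a n (of_nat n * y) * s \<and>
        norm (s - (\<Sum>m<N. kummer_coeff a m y / of_nat n ^ m)) \<le> M / real n ^ N"
      by auto
  qed
qed

text \<open>This is the price, relative to (-z)_n, of subtracting the subdominant term on a circle.
  With r = n-m-1, the bounds |1/Gamma(n+1-z)| <= B 2^(r+1)/(r+1)! and |(-z)_n| >= 2^(-n) m! r! turn
  n! into binom(n,m) and leave 1/r!; the condition on m gives r >= n div L.\<close>

lemma subdominant_on_node_circle_small:
  assumes a: "a > 0" and c: "0 < c" "c \<le> 1" and L: "L \<ge> 1"
  shows "\<exists>M. \<forall>n\<ge>1. \<forall>m z. norm (z - of_nat m) = 1 / 2 \<and> m + n div L + 1 \<le> n \<and>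
      norm (z / of_nat n) \<le> 2 \<and> c \<le> Re (1 - z / of_nat n) \<longrightarrow>
      norm (inverse ((- of_real a) ^ m) * subdominant a n z / pochhammer (- z) n) \<le> M / real n ^ N"
proof -
  have "compact (rGamma ` cball (1::complex) 1)"
    by (intro compact_continuous_image holomorphic_on_imp_continuous_on holomorphic_rGamma) auto
  then obtain B where B: "\<And>s. s \<in> cball (1::complex) 1 \<Longrightarrow> norm (rGamma s) \<le> B"
    by (meson bounded_iff compact_imp_bounded image_eqI)
  have B0: "B \<ge> 0"
    using order_trans[OF norm_ge_zero B[of 1]] by simp
  define A where "A = max 1 a"
  have A: "A \<ge> 1" "A \<ge> a" by (auto simp: A_def)
  obtain C where C: "C > 0" "\<And>n. (16 * A) ^ n * real (Suc n) ^ N \<le> C * fact (n div L)"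
    using power_poly_le_fact_div[of "16 * A" L N] L A(1) by fastforce
  define E where "E = exp (a * (2 / c))"
  have "norm (inverse ((- of_real a) ^ m) * subdominant a n z / pochhammer (- z) n) \<le> B * E * C / real n ^ N"
    if n: "n \<ge> 1" and zm: "norm (z - of_nat m) = 1 / 2" and m: "m + n div L + 1 \<le> n"
      and z2: "norm (z / of_nat n) \<le> 2" and Rez: "c \<le> Re (1 - z / of_nat n)" for n m z
  proof -
    \<comment> \<open>s has distance 1/2 from 1, so 1/Gamma(s) is bounded independently of m; r + 1
      unit steps lead from s to n+1-z.\<close>
    define s where "s = of_nat m + 1 - z"
    define r where "r = n - m - 1"
    have nm: "n = m + Suc r" using m by (simp add: r_def)
    have Re: "\<bar>Re (z - of_nat m)\<bar> \<le> 1 / 2"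
      using abs_Re_le_cmod[of "z - of_nat m"] zm by simp
    have Res: "1 / 2 \<le> Re s"
      using Re abs_ge_self[of "Re (z - of_nat m)"] by (simp add: s_def)
    have Rg: "norm (rGamma (of_nat n + 1 - z)) \<le> B * 2 ^ Suc r / fact (Suc r)"
    proof -
      have "rGamma s = pochhammer s (Suc r) * rGamma (s + of_nat (Suc r))"
        by (rule pochhammer_rGamma)
      also have "s + of_nat (Suc r) = of_nat n + 1 - z"
        by (simp add: s_def nm)
      finally have eq: "norm (rGamma s) = norm (pochhammer s (Suc r)) * norm (rGamma (of_nat n + 1 - z))"
        by (simp only: norm_mult)
      have "(1 / 2) ^ Suc r * fact (Suc r) \<le> norm (pochhammer s (Suc r))"
        using Res by (intro norm_pochhammer_ge) auto
      then have "(1 / 2) ^ Suc r * fact (Suc r) * norm (rGamma (of_nat n + 1 - z))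
          \<le> norm (pochhammer s (Suc r)) * norm (rGamma (of_nat n + 1 - z))"
        by (rule mult_right_mono) simp
      also have "\<dots> \<le> B"
        unfolding eq[symmetric] using zm by (intro B) (simp add: s_def dist_norm)
      finally have le: "(1 / 2) ^ Suc r * fact (Suc r) * norm (rGamma (of_nat n + 1 - z)) \<le> B" .
      have q: "(1 / 2) ^ Suc r * fact (Suc r) > (0::real)"
        by (intro mult_pos_pos zero_less_power fact_gt_zero) simp
      have "norm (rGamma (of_nat n + 1 - z)) \<le> B / ((1 / 2) ^ Suc r * fact (Suc r))"
        using le by (subst pos_le_divide_eq[OF q]) (subst mult.commute)
      also have "\<dots> = B * 2 ^ Suc r / fact (Suc r)"
        by (simp add: power_one_over del: power_Suc fact_Suc)
      finally show ?thesis .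
    qed
    have P: "(1 / 2) ^ n * (fact m * fact r) \<le> norm (pochhammer (- z) n)"
    proof -
      \<comment> \<open>The factors are split at m - z, of modulus 1/2. Those before it are
        reflected, so that both remaining Pochhammer products start at real part at least
        1/2.\<close>
      have "pochhammer (- z) n = pochhammer (- z) m * pochhammer (- z + of_nat m) (Suc r)"
        unfolding nm by (rule pochhammer_product')
      also have "pochhammer (- z + of_nat m) (Suc r) = (of_nat m - z) * pochhammer s r"
        by (simp add: pochhammer_rec s_def algebra_simps)
      also have "pochhammer (- z) m = (-1) ^ m * pochhammer (z - of_nat m + 1) m"
        by (rule pochhammer_minus)
      finally have "norm (pochhammer (- z) n) = norm (pochhammer (z - of_nat m + 1) m) * (1 / 2 * norm (pochhammer s r))"
        using zm by (simp add: norm_mult norm_power norm_minus_commute)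
      moreover have "(1 / 2) ^ m * fact m \<le> norm (pochhammer (z - of_nat m + 1) m)"
        using Re abs_ge_minus_self[of "Re (z - of_nat m)"] by (intro norm_pochhammer_ge) auto
      moreover have "(1 / 2) ^ r * fact r \<le> norm (pochhammer s r)"
        using Res by (intro norm_pochhammer_ge) auto
      ultimately have "((1 / 2) ^ m * fact m) * (1 / 2 * ((1 / 2) ^ r * fact r)) \<le> norm (pochhammer (- z) n)"
        by (simp only:) (intro mult_mono mult_left_mono mult_nonneg_nonneg zero_le_power norm_ge_zero fact_ge_zero; simp)
      then show ?thesis
        by (simp add: nm power_add mult_ac)
    qed
    have p0: "norm (pochhammer (- z) n) > 0"
      using P by (rule less_le_trans[rotated]) simp
    have K: "norm (kummer_series a n z) \<le> B * 2 ^ Suc r / fact (Suc r) * E"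
    proof -
      have "norm (kummer_series a n z) \<le> norm (rGamma (of_nat n + 1 - z)) * E"
        using norm_kummer_series_le[OF a c Rez z2 n] n by (simp add: E_def)
      also have "\<dots> \<le> B * 2 ^ Suc r / fact (Suc r) * E"
        using Rg by (intro mult_right_mono) (auto simp: E_def)
      finally show ?thesis .
    qed
    have an: "a ^ n = a ^ m * a ^ Suc r"
      by (simp only: nm power_add)
    have "norm (inverse ((- of_real a) ^ m) * subdominant a n z) = a ^ Suc r * fact n * norm (kummer_series a n z)"
      using a by (simp add: subdominant_def norm_mult norm_power norm_inverse an)
    also have "\<dots> \<le> A ^ n * fact n * (B * 2 ^ n / fact (Suc r) * E)"
    proof (rule mult_mono[OF mult_mono])
      show "a ^ Suc r \<le> A ^ n"
        using a A nm by (intro order_trans[OF power_mono power_increasing]) auto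
      have "(2::real) ^ Suc r \<le> 2 ^ n" using nm by (intro power_increasing) auto
      then have "B * 2 ^ Suc r / fact (Suc r) * E \<le> B * 2 ^ n / fact (Suc r) * E"
        using B0 by (intro mult_right_mono divide_right_mono mult_left_mono) (auto simp: E_def)
      then show "norm (kummer_series a n z) \<le> B * 2 ^ n / fact (Suc r) * E"
        using K by linarith
    qed (use A a in auto)
    finally have "norm (inverse ((- of_real a) ^ m) * subdominant a n z / pochhammer (- z) n)
        \<le> A ^ n * fact n * (B * 2 ^ n / fact (Suc r) * E) / ((1 / 2) ^ n * (fact m * fact r))"
      unfolding norm_divide using P p0 A B0 by (intro frac_le) (auto simp: E_def)
    also have "\<dots> = B * E * (4 * A) ^ n * (fact n / (fact m * fact (Suc r))) / fact r"
    proof -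
      have "(4 * A) ^ n = A ^ n * 2 ^ n * 2 ^ n"
        unfolding power_mult_distrib[symmetric] by simp
      then show ?thesis by (simp only:) (simp add: power_divide mult_ac)
    qed
    also have "fact n / (fact m * fact (Suc r)) = real (n choose m)"
      using binomial_fact[of m n, where ?'a = real] nm by simp
    also have "B * E * (4 * A) ^ n * real (n choose m) / fact r \<le> B * E * (4 * A) ^ n * 2 ^ n / fact (n div L)"
    proof (intro frac_le mult_left_mono)
      show "real (n choose m) \<le> 2 ^ n"
        using of_nat_mono[OF binomial_le_pow2[of n m], where ?'a = real] by simp
      show "fact (n div L) \<le> (fact r :: real)"
        using m by (intro fact_mono) (simp add: r_def)
    qed (use A B0 in \<open>auto simp: E_def\<close>)
    \<comment> \<open>The base 8 A collects A^n, one factor 2^n each from the Gamma and the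
      Pochhammer bound, and one from the binomial coefficient.\<close>
    also have "\<dots> \<le> B * E * C / real n ^ N"
    proof -
      have "(8 * A) ^ n * real n ^ N \<le> (16 * A) ^ n * real (Suc n) ^ N"
        using A by (intro mult_mono power_mono) auto
      also have "\<dots> \<le> C * fact (n div L)" by (rule C)
      finally have "(8 * A) ^ n / fact (n div L) \<le> C / real n ^ N"
        using n by (simp add: field_simps)
      then have "B * E * ((8 * A) ^ n / fact (n div L)) \<le> B * E * (C / real n ^ N)"
        using B0 by (intro mult_left_mono) (auto simp: E_def)
      moreover have "(8 * A) ^ n = (4 * A) ^ n * 2 ^ n"
        unfolding power_mult_distrib[symmetric] by simp
      ultimately have "B * E * ((4 * A) ^ n * 2 ^ n / fact (n div L)) \<le> B * E * (C / real n ^ N)"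
        by (simp only:)
      then show ?thesis by (simp add: mult_ac)
    qed
    finally show ?thesis .
  qed
  then show ?thesis by blast
qed

section \<open>The dominant solution\<close>

text \<open>A negative rounded value is cut off to 0. This does no harm: a point with Re x < 0 can
  be within 1/2 of the node 0 only.\<close>

definition nearest_node :: "complex \<Rightarrow> nat" where
  "nearest_node x = nat (round (Re x))"

definition near_node :: "complex \<Rightarrow> bool" where
  "near_node x \<longleftrightarrow> norm (x - of_nat (nearest_node x)) < 1 / 2"

lemma nearest_node_eq:
  assumes "norm (x - of_nat m) < 1 / 2"
  shows "nearest_node x = m"
proof -
  have "\<bar>Re (x - of_nat m)\<bar> < 1 / 2"
    using abs_Re_le_cmod assms by (rule le_less_trans)
  then have "round (Re x) = int m"
    by (intro round_unique') simp
  then show ?thesis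
    by (simp add: nearest_node_def)
qed

lemma not_near_nodeD: "\<not> near_node x \<Longrightarrow> 1 / 2 \<le> norm (x - of_nat m)"
  unfolding near_node_def using nearest_node_eq[of x m] by fastforce

lemma of_nat_in_node_disc:
  assumes "norm (of_nat k - of_nat m :: complex) < 1"
  shows "k = m"
proof -
  have "(of_nat k - of_nat m :: complex) = of_int (int k - int m)" by simp
  then have "\<bar>int k - int m\<bar> < 1"
    using assms norm_of_int[of "int k - int m", where ?'a = complex] by simp
  then show ?thesis by simp
qed

definition node_weight :: "real \<Rightarrow> complex \<Rightarrow> complex" where
  "node_weight a x = (if near_node x then inverse ((- of_real a) ^ nearest_node x) else 0)"

definition node_diff :: "real \<Rightarrow> nat \<Rightarrow> nat \<Rightarrow> complex \<Rightarrow> complex" where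
  "node_diff a n m x = charlier a n x - inverse ((- of_real a) ^ m) * subdominant a n x"

definition node_quot :: "real \<Rightarrow> nat \<Rightarrow> nat \<Rightarrow> complex \<Rightarrow> complex" where
  "node_quot a n m x = (if x = of_nat m then deriv (node_diff a n m) (of_nat m)
     else node_diff a n m x / (x - of_nat m))"

text \<open>Gamma(-x) times \<open>node_diff\<close>, rewritten by Gamma(-x) = Gamma(m+1-x)/((-x)_m
  (m-x)): the zero of \<open>node_diff\<close> cancels the simple pole at m, and the minus sign
  comes from m-x = -(x-m).\<close>

definition dominant_near :: "real \<Rightarrow> nat \<Rightarrow> nat \<Rightarrow> complex \<Rightarrow> complex" where
  "dominant_near a n m x = - (Gamma (of_nat m + 1 - x) / pochhammer (- x) m * node_quot a n m x)"

text \<open>Jumps across the circles are allowed: recurrence, independence and limits are pointwise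
  in x, and the expansion asks for uniform bounds but not for continuity.\<close>

definition dominant :: "real \<Rightarrow> nat \<Rightarrow> complex \<Rightarrow> complex" where
  "dominant a n x =
     (if near_node x then dominant_near a n (nearest_node x) x else Gamma (- x) * charlier a n x)"

lemma holomorphic_on_charlier: "charlier a n holomorphic_on S"
  unfolding charlier_def[abs_def] gbinomial_pochhammer by (intro holomorphic_intros) auto

lemma holomorphic_on_node_diff: "a > 0 \<Longrightarrow> node_diff a n m holomorphic_on S"
  unfolding node_diff_def[abs_def]
  by (intro holomorphic_intros holomorphic_on_charlier holomorphic_on_subdominant)

lemma node_diff_at_node: "a > 0 \<Longrightarrow> node_diff a n m (of_nat m) = 0"
  by (simp add: node_diff_def charlier_of_nat)

lemma holomorphic_on_node_quot:
  assumes "a > 0"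
  shows "node_quot a n m holomorphic_on S"
proof -
  have "node_quot a n m holomorphic_on UNIV"
    using pole_lemma_open[OF holomorphic_on_node_diff[OF assms, where n = n and m = m] open_UNIV, of "of_nat m"]
    by (simp add: node_quot_def[abs_def] node_diff_at_node[OF assms] cong: if_cong)
  then show ?thesis
    by (rule holomorphic_on_subset) auto
qed

lemma pochhammer_node_disc_nonzero:
  fixes x :: complex
  assumes "norm (x - of_nat m) < 1"
  shows "pochhammer (- x) m \<noteq> 0"
proof
  assume "pochhammer (- x) m = 0"
  then obtain k where "k < m" "x = of_nat k"
    by (auto simp: pochhammer_eq_0_iff)
  then show False
    using of_nat_in_node_disc[of k m] assms by simp
qed

lemma Re_pos_notin_nonpos_Ints: "Re z > 0 \<Longrightarrow> z \<notin> \<int>\<^sub>\<le>\<^sub>0"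
  by (auto elim!: nonpos_Ints_cases)

text \<open>The neighbouring nodes, as zeros of (-x)_m or poles of Gamma(m+1-x), are at distance 1
  or more. This leaves room around the closed disc of radius 1/2, to which the maximum modulus
  principle is applied.\<close>

lemma holomorphic_on_dominant_near:
  assumes "a > 0" "S \<subseteq> ball (of_nat m) 1"
  shows "dominant_near a n m holomorphic_on S"
  unfolding dominant_near_def[abs_def]
proof (intro holomorphic_intros holomorphic_on_node_quot assms)
  fix x assume "x \<in> S"
  then have x: "norm (x - of_nat m) < 1"
    using assms(2) by (auto simp: dist_norm norm_minus_commute)
  show "pochhammer (- x) m \<noteq> 0"
    using x by (rule pochhammer_node_disc_nonzero)
  have "Re (x - of_nat m) < 1"
    using complex_Re_le_cmod x by (rule le_less_trans)
  then show "of_nat m + 1 - x \<notin> \<int>\<^sub>\<le>\<^sub>0"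
    by (intro Re_pos_notin_nonpos_Ints) simp
qed

lemma node_disc_minus_notin_nonpos_Ints:
  fixes x :: complex
  assumes "norm (x - of_nat m) < 1" "x \<noteq> of_nat m"
  shows "- x \<notin> \<int>\<^sub>\<le>\<^sub>0"
proof
  assume "- x \<in> \<int>\<^sub>\<le>\<^sub>0"
  then obtain k where "x = of_nat k"
    by (auto elim!: nonpos_Ints_cases')
  then show False
    using of_nat_in_node_disc[of k m] assms by simp
qed

lemma dominant_near_eq:
  fixes x :: complex
  assumes "norm (x - of_nat m) < 1" "x \<noteq> of_nat m"
  shows "dominant_near a n m x = Gamma (- x) * node_diff a n m x"
proof -
  have x: "- x \<notin> \<int>\<^sub>\<le>\<^sub>0"
    using assms by (rule node_disc_minus_notin_nonpos_Ints)
  then have G: "Gamma (- x) \<noteq> 0"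
    by (simp add: Gamma_eq_zero_iff)
  have "pochhammer (- x) (Suc m) = Gamma (- x + of_nat (Suc m)) / Gamma (- x)"
    using x by (rule pochhammer_Gamma)
  also have "- x + of_nat (Suc m) = of_nat m + 1 - x" by simp
  finally have "Gamma (of_nat m + 1 - x) = pochhammer (- x) m * (of_nat m - x) * Gamma (- x)"
    using G by (simp add: pochhammer_Suc)
  moreover have "pochhammer (- x) m \<noteq> 0"
    using assms(1) by (rule pochhammer_node_disc_nonzero)
  ultimately have "dominant_near a n m x = - ((of_nat m - x) * Gamma (- x) * (node_diff a n m x / (x - of_nat m)))"
    using assms(2) by (simp add: dominant_near_def node_quot_def)
  also have "\<dots> = Gamma (- x) * node_diff a n m x"
    using assms(2) by (simp add: field_simps)
  finally show ?thesis .
qed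

lemma not_near_node_notin_nonpos_Ints:
  fixes x :: complex
  assumes "\<not> near_node x"
  shows "- x \<notin> \<int>\<^sub>\<le>\<^sub>0"
proof
  assume "- x \<in> \<int>\<^sub>\<le>\<^sub>0"
  then obtain k where "x = of_nat k"
    by (auto elim!: nonpos_Ints_cases')
  then show False
    using not_near_nodeD[OF assms, of k] by simp
qed

lemma rGamma_mult_Gamma: "z \<notin> \<int>\<^sub>\<le>\<^sub>0 \<Longrightarrow> rGamma z * Gamma z = (1 :: complex)"
  by (simp add: rGamma_inverse_Gamma Gamma_eq_zero_iff)

text \<open>At a node 1/Gamma(-x) = 0 and the identity is the value of the polynomial there; at
  every other point it only uses that 1/Gamma(-x) cancels the factor Gamma(-x) of the dominant
  solution.\<close>

lemma charlier_decomposition: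
  assumes "a > 0"
  shows "charlier a n x = rGamma (- x) * dominant a n x + node_weight a x * subdominant a n x"
proof (cases "near_node x")
  case False
  then show ?thesis
    using rGamma_mult_Gamma[OF not_near_node_notin_nonpos_Ints[OF False]]
    by (simp add: dominant_def node_weight_def)
next
  case True
  define m where "m = nearest_node x"
  show ?thesis
  proof (cases "x = of_nat m")
    case x: True
    have "rGamma (- x) = 0"
      by (simp add: x rGamma_eq_zero_iff)
    then show ?thesis
      using True charlier_of_nat[OF assms, of n m] nearest_node_eq[of "of_nat m" m]
      by (simp add: node_weight_def x)
  next
    case x: False
    have xm: "norm (x - of_nat m) < 1"
      using True by (simp add: near_node_def m_def)
    have "rGamma (- x) * dominant a n x = (rGamma (- x) * Gamma (- x)) * node_diff a n m x"
      using True dominant_near_eq[OF xm x, of a n] by (simp add: dominant_def flip: m_def)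
    also have "\<dots> = node_diff a n m x"
      using rGamma_mult_Gamma[OF node_disc_minus_notin_nonpos_Ints[OF xm x]] by simp
    finally show ?thesis
      using True by (simp add: node_weight_def node_diff_def flip: m_def)
  qed
qed

section \<open>Recurrence in n for the dominant solution\<close>

lemma node_diff_recurrence:
  assumes "a > 0" "n \<ge> 1"
  shows "x * node_diff a n m x = node_diff a (Suc n) m x + (of_nat n + of_real a) * node_diff a n m x
           + of_real a * of_nat n * node_diff a (n - 1) m x"
proof -
  define c where "c = inverse ((- of_real a) ^ m :: complex)"
  have "x * subdominant a n x = subdominant a (Suc n) x + (of_nat n + of_real a) * subdominant a n x
      + of_real a * of_nat n * subdominant a (n - 1) x"
    using charlier_rec_subdominant[OF assms(1)] assms(2) by (simp add: charlier_rec_def)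
  then have "c * (x * subdominant a n x) = c * (subdominant a (Suc n) x + (of_nat n + of_real a) * subdominant a n x
      + of_real a * of_nat n * subdominant a (n - 1) x)"
    by (simp only:)
  then show ?thesis
    using charlier_recurrence[of x a n] unfolding node_diff_def c_def[symmetric]
    by (simp add: algebra_simps)
qed

lemma node_quot_recurrence:
  assumes "a > 0" "n \<ge> 1"
  shows "x * node_quot a n m x = node_quot a (Suc n) m x + (of_nat n + of_real a) * node_quot a n m x
           + of_real a * of_nat n * node_quot a (n - 1) m x"
proof (cases "x = of_nat m")
  case False
  have "x * (node_diff a n m x / (x - of_nat m)) = (x * node_diff a n m x) / (x - of_nat m)"
    by simp
  also have "\<dots> = node_diff a (Suc n) m x / (x - of_nat m)
      + (of_nat n + of_real a) * (node_diff a n m x / (x - of_nat m))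
      + of_real a * of_nat n * (node_diff a (n - 1) m x / (x - of_nat m))"
    unfolding node_diff_recurrence[OF assms] by (simp only: add_divide_distrib times_divide_eq_right)
  finally show ?thesis
    using False by (simp add: node_quot_def)
next
  case True
  have D: "(node_diff a n m has_field_derivative deriv (node_diff a n m) x) (at x)" for n
    by (rule holomorphic_derivI[OF holomorphic_on_node_diff[OF assms(1)] open_UNIV UNIV_I])
  \<comment> \<open>At the node the quotients are derivatives, so the recurrence is differentiated
    in x; the extra term of the product rule vanishes because \<open>node_diff\<close> is zero
    there.\<close>
  have "((\<lambda>x. x * node_diff a n m x) has_field_derivative
      node_diff a n m x + x * deriv (node_diff a n m) x) (at x)"
    by (rule derivative_eq_intros D refl)+ (simp add: mult.commute)
  moreover have "((\<lambda>x. x * node_diff a n m x) has_field_derivative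
      deriv (node_diff a (Suc n) m) x + (of_nat n + of_real a) * deriv (node_diff a n m) x
           + of_real a * of_nat n * deriv (node_diff a (n - 1) m) x) (at x)"
    unfolding node_diff_recurrence[OF assms]
    by (intro DERIV_add DERIV_cmult D)
  ultimately have "node_diff a n m x + x * deriv (node_diff a n m) x =
      deriv (node_diff a (Suc n) m) x + (of_nat n + of_real a) * deriv (node_diff a n m) x
           + of_real a * of_nat n * deriv (node_diff a (n - 1) m) x"
    by (rule DERIV_unique)
  then show ?thesis
    using True node_diff_at_node[OF assms(1), of n m] by (simp add: node_quot_def)
qed

lemma charlier_rec_dominant:
  assumes "a > 0"
  shows "charlier_rec a (dominant a)"
  unfolding charlier_rec_def
proof (intro allI impI)
  fix n :: nat and x assume n: "n \<ge> 1"
  show "x * dominant a n x = dominant a (Suc n) x + (of_nat n + of_real a) * dominant a n x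
      + of_real a * of_nat n * dominant a (n - 1) x"
  proof (cases "near_node x")
    case True
    define m where "m = nearest_node x"
    \<comment> \<open>The prefactor depends on x and its node but not on n, so it does not disturb
      the recurrence.\<close>
    define g where "g = - (Gamma (of_nat m + 1 - x) / pochhammer (- x) m)"
    have dom: "dominant a k x = g * node_quot a k m x" for k
      using True by (simp add: dominant_def dominant_near_def g_def m_def)
    have "x * dominant a n x = g * (x * node_quot a n m x)"
      by (simp add: dom)
    then show ?thesis
      unfolding node_quot_recurrence[OF assms n] by (simp add: dom algebra_simps)
  next
    case False
    then have dom: "dominant a k x = Gamma (- x) * charlier a k x" for k
      by (simp add: dominant_def)
    have "x * dominant a n x = Gamma (- x) * (x * charlier a n x)"
      by (simp add: dom)
    then show ?thesis
      unfolding charlier_recurrence by (simp add: dom algebra_simps)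
  qed
qed

section \<open>Uniform expansion of the dominant solution across the discs\<close>

lemma Re_one_minus_ge:
  fixes y :: complex
  assumes "norm y < 1" "\<delta> \<le> norm (1 - y)" "0 \<le> \<delta>"
  shows "\<delta>\<^sup>2 / 2 \<le> Re (1 - y)"
proof -
  have "\<delta>\<^sup>2 \<le> (norm (1 - y))\<^sup>2"
    using assms by (intro power_mono) auto
  also have "\<dots> = 1 - 2 * Re y + (norm y)\<^sup>2"
    unfolding cmod_power2 by (simp add: power2_eq_square algebra_simps)
  also have "(norm y)\<^sup>2 \<le> 1"
    using assms(1) by (simp add: power_le_one)
  finally show ?thesis by simp
qed

text \<open>The region is larger than |y| <= \<rho> because the leading approximation must hold up
  to the unit circle away from 1. Multiplying by 1/Gamma(n-x) leaves an additive error that is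
  holomorphic on each disc, as the maximum modulus principle requires.\<close>

lemma dominant_expansion:
  assumes a: "a > 0" and \<delta>: "\<delta> > 0" and N: "N \<ge> 1"
  shows "\<exists>M. \<forall>\<^sub>F n in sequentially. \<forall>y. norm y < 1 \<and> \<delta> \<le> norm (1 - y) \<longrightarrow>
     norm ((-1) ^ n * rGamma (of_nat n - of_nat n * y) * dominant a n (of_nat n * y)
       - (\<Sum>m<N. charlier_coeff a m y / of_nat n ^ m)) \<le> M / real n ^ N"
proof -
  define \<delta>' where "\<delta>' = min \<delta> 1"
  \<comment> \<open>Half of the lower bound \<delta>'^2/2 for Re(1-y): from Re(1-y) >= 2 c a margin
    c remains when y moves by at most 1/n within a disc.\<close>
  define c where "c = \<delta>'\<^sup>2 / 4"
  have \<delta>': "0 < \<delta>'" "\<delta>' \<le> 1" "\<delta>' \<le> \<delta>" using \<delta> by (auto simp: \<delta>'_def)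
  then have c: "0 < c" "c \<le> 1 / 4" by (auto simp: c_def power_le_one)
  define L where "L = nat \<lceil>2 / c\<rceil> + 1"
  have L: "L \<ge> 1" "2 / c \<le> real L"
    unfolding L_def by (simp, linarith)
  have "\<delta>' / 2 > 0" "c \<le> 1" using \<delta>' c by auto
  from charlier_expansion[OF a this(1) N] obtain M1 where
    "\<forall>n\<ge>1. \<forall>y. \<delta>' / 2 \<le> norm (1 - y) \<and> (\<forall>j<n. 1 / 2 \<le> norm (of_nat n * y - of_nat j)) \<longrightarrow>
     (\<exists>s. charlier a n (of_nat n * y) = (-1) ^ n * pochhammer (- (of_nat n * y)) n * s \<and>
        norm (s - (\<Sum>m<N. charlier_coeff a m y / of_nat n ^ m)) \<le> M1 / real n ^ N)" ..
  note M1 = this[rule_format, OF _ conjI]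
  from subdominant_on_node_circle_small[OF a c(1) \<open>c \<le> 1\<close> L(1), of N] obtain M2 where
    "\<forall>n\<ge>1. \<forall>m z. norm (z - of_nat m) = 1 / 2 \<and> m + n div L + 1 \<le> n \<and>
      norm (z / of_nat n) \<le> 2 \<and> c \<le> Re (1 - z / of_nat n) \<longrightarrow>
      norm (inverse ((- of_real a) ^ m) * subdominant a n z / pochhammer (- z) n) \<le> M2 / real n ^ N" ..
  note M2 = this[rule_format]
  define S where "S n y = (\<Sum>m<N. charlier_coeff a m y / of_nat n ^ m)" for n y
  have main: "norm ((-1) ^ n * rGamma (of_nat n - of_nat n * y) * dominant a n (of_nat n * y) - S n y)
      \<le> (\<bar>M1\<bar> + \<bar>M2\<bar>) / real n ^ N"
    if n: "real n \<ge> 2 / c" and y: "norm y < 1" "\<delta> \<le> norm (1 - y)" for n y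
  proof -
    have "2 / c \<ge> 8" using c by (simp add: field_simps)
    then have n8: "real n \<ge> 8" "n \<ge> 1" using n by linarith+
    then have n0: "of_nat n \<noteq> (0::complex)" by auto
    have nc: "real n * c \<ge> 2" using n c by (simp add: field_simps)
    define x where "x = of_nat n * y"
    have nx: "norm x < real n" using y n8 by (simp add: x_def norm_mult)
    have yx: "y = x / of_nat n" using n0 by (simp add: x_def)
    have Rey: "2 * c \<le> Re (1 - y)"
      using Re_one_minus_ge[of y \<delta>'] y \<delta>' by (simp add: c_def)
    have "Re (of_nat n - x) > 0"
      using complex_Re_le_cmod[of x] nx by simp
    then have nxG: "of_nat n - x \<notin> \<int>\<^sub>\<le>\<^sub>0"
      by (rule Re_pos_notin_nonpos_Ints)
    show ?thesis
    proof (cases "near_node x")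
      case False
      have far: "\<And>j. j < n \<Longrightarrow> 1 / 2 \<le> norm (of_nat n * y - of_nat j)"
        using not_near_nodeD[OF False] by (simp add: x_def)
      obtain s where s: "charlier a n x = (-1) ^ n * pochhammer (- x) n * s"
          "norm (s - S n y) \<le> M1 / real n ^ N"
        using M1[OF n8(2) _ allI[OF impI[OF far]]] y \<delta>' unfolding x_def S_def by fastforce
      have mx: "- x \<notin> \<int>\<^sub>\<le>\<^sub>0" using False by (rule not_near_node_notin_nonpos_Ints)
      have "(-1) ^ n * rGamma (of_nat n - x) * dominant a n x
          = ((-1) ^ n * (-1) ^ n) * (rGamma (of_nat n - x) * (pochhammer (- x) n * Gamma (- x))) * s"
        using False by (simp add: dominant_def s(1))
      also have "pochhammer (- x) n * Gamma (- x) = Gamma (of_nat n - x)"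
        using pochhammer_Gamma[OF mx, of n] mx by (simp add: Gamma_eq_zero_iff)
      also have "rGamma (of_nat n - x) * Gamma (of_nat n - x) = 1"
        using nxG by (rule rGamma_mult_Gamma)
      also have "(-1) ^ n * (-1) ^ n = (1 :: complex)"
        by (simp flip: power_mult_distrib)
      finally have "(-1) ^ n * rGamma (of_nat n - x) * dominant a n x = s" by simp
      moreover have "M1 / real n ^ N \<le> (\<bar>M1\<bar> + \<bar>M2\<bar>) / real n ^ N"
        by (intro divide_right_mono) auto
      ultimately show ?thesis
        using s(2) by (simp add: x_def)
    next
      case True
      define m where "m = nearest_node x"
      have xm: "norm (x - of_nat m) < 1 / 2"
        using True by (simp add: near_node_def m_def)
      have disc: "c \<le> Re (1 - z / of_nat n)" "norm (z / of_nat n) \<le> 2" "\<delta>' / 2 \<le> norm (1 - z / of_nat n)"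
        if z: "norm (z - of_nat m) \<le> 1 / 2" for z
      proof -
        have "norm (z - x) \<le> norm (z - of_nat m) + norm (x - of_nat m)"
          using norm_triangle_ineq4[of "z - of_nat m" "x - of_nat m"] by simp
        then have zx: "norm (z - x) \<le> 1" using z xm by simp
        have d: "norm (z / of_nat n - y) \<le> c / 2"
        proof -
          have "norm (z / of_nat n - y) = norm (z - x) / real n"
            by (simp add: yx norm_divide flip: diff_divide_distrib)
          also have "\<dots> \<le> 1 / real n"
            using zx by (intro divide_right_mono) auto
          also have "\<dots> \<le> c / 2"
            using nc n8 by (simp add: field_simps)
          finally show ?thesis .
        qed
        have "Re (z / of_nat n - y) \<le> c / 2"
          using complex_Re_le_cmod d by (rule order_trans)
        then show "c \<le> Re (1 - z / of_nat n)"
          using Rey c by simp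
        show "norm (z / of_nat n) \<le> 2"
          using norm_triangle_ineq[of y "z / of_nat n - y"] d y c by simp
        have "c / 2 \<le> \<delta>' / 2"
          using \<delta>' mult_right_mono[of \<delta>' 1 \<delta>'] by (simp add: c_def power2_eq_square)
        moreover have "norm (1 - y) \<le> norm (1 - z / of_nat n) + norm (z / of_nat n - y)"
          using norm_triangle_ineq[of "1 - z / of_nat n" "z / of_nat n - y"] by simp
        ultimately show "\<delta>' / 2 \<le> norm (1 - z / of_nat n)"
          using d y \<delta>' by linarith
      qed
      \<comment> \<open>Re y <= 1 - 2 c puts m below n - 2 n c + 1/2, and n div L is at most n c/2;
        n c >= 2 leaves room for the additional 1.\<close>
      have mn: "m + n div L + 1 \<le> n"
      proof -
        have "real m - 1 / 2 \<le> Re x"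
          using abs_Re_le_cmod[of "x - of_nat m"] xm by simp
        also have "Re x = real n * Re y" by (simp add: x_def)
        also have "\<dots> \<le> real n * (1 - 2 * c)"
          using Rey by (intro mult_left_mono) auto
        finally have "real m \<le> real n - 2 * (real n * c) + 1 / 2"
          by (simp add: algebra_simps)
        moreover have "real (n div L) \<le> real n * c / 2"
        proof -
          have "real (n div L) \<le> real n / real L" by (rule of_nat_div_le_of_nat)
          also have "\<dots> \<le> real n / (2 / c)"
            using L c by (intro divide_left_mono) auto
          finally show ?thesis by simp
        qed
        ultimately have "real m + real (n div L) + 1 \<le> real n"
          using nc by linarith
        then show ?thesis by linarith
      qed
      \<comment> \<open>The expansion is taken at the moving point z/n: on the circle the estimates
        are available there, and at z = x it is y again.\<close>
      define E where "E z = (-1) ^ n * rGamma (of_nat n - z) * dominant_near a n m z - S n (z / of_nat n)" for z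
      have holE: "E holomorphic_on cball (of_nat m) (1 / 2)"
      proof -
        have "(charlier_coeff a k \<circ> (\<lambda>z. z / of_nat n)) holomorphic_on cball (of_nat m) (1 / 2)" for k
        proof (rule holomorphic_on_compose_gen)
          show "charlier_coeff a k holomorphic_on - {1}"
            using a by (rule holomorphic_on_charlier_coeff)
          show "(\<lambda>z. z / of_nat n) holomorphic_on cball (of_nat m) (1 / 2)"
            using n0 by (intro holomorphic_intros) auto
          have "z / of_nat n \<noteq> 1" if "z \<in> cball (of_nat m) (1 / 2)" for z :: complex
            using disc(3)[of z] that \<delta>' by (auto simp: dist_norm norm_minus_commute)
          then show "(\<lambda>z. z / of_nat n) ` cball (of_nat m :: complex) (1 / 2) \<subseteq> - {1}"
            by (simp only: image_subset_iff Compl_iff singleton_iff) blast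
        qed
        then have "(\<lambda>z. charlier_coeff a k (z / of_nat n)) holomorphic_on cball (of_nat m) (1 / 2)" for k
          by (simp add: o_def)
        then show ?thesis
          unfolding E_def[abs_def] S_def using n0
          by (intro holomorphic_intros holomorphic_on_dominant_near a) (auto simp: cball_subset_ball_iff)
      qed
      have circle: "norm (E z) \<le> (\<bar>M1\<bar> + \<bar>M2\<bar>) / real n ^ N"
        if "z \<in> frontier (cball (of_nat m) (1 / 2))" for z
      proof -
        have zm: "norm (z - of_nat m) = 1 / 2"
          using that by (simp add: dist_norm norm_minus_commute)
        have zm': "norm (z - of_nat m) < 1" "z \<noteq> of_nat m" using zm by auto
        have far: "1 / 2 \<le> norm (z - of_nat j)" for j
        proof (cases "j = m")
          case False
          then have "1 \<le> norm (of_nat j - of_nat m :: complex)"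
            using of_nat_in_node_disc[of j m] by fastforce
          also have "\<dots> \<le> norm (z - of_nat m) + norm (z - of_nat j)"
            using norm_triangle_ineq4[of "z - of_nat m" "z - of_nat j"] by simp
          finally show ?thesis using zm by simp
        qed (use zm in simp)
        have zz: "of_nat n * (z / of_nat n) = z" using n0 by simp
        obtain s where s: "charlier a n z = (-1) ^ n * pochhammer (- z) n * s"
          "norm (s - S n (z / of_nat n)) \<le> M1 / real n ^ N"
          using M1[of n "z / of_nat n"] n8 disc[of z] zm far unfolding zz S_def by fastforce
        define X where "X = inverse ((- of_real a) ^ m) * subdominant a n z / pochhammer (- z) n"
        have X: "norm X \<le> M2 / real n ^ N"
          unfolding X_def using n8 zm mn disc[of z] by (intro M2) auto
        have mz: "- z \<notin> \<int>\<^sub>\<le>\<^sub>0"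
          using zm' by (rule node_disc_minus_notin_nonpos_Ints)
        have p: "rGamma (of_nat n - z) * Gamma (- z) * pochhammer (- z) n = 1"
          using pochhammer_rGamma[of "- z" n] rGamma_mult_Gamma[OF mz] by (simp add: mult_ac)
        then have p0: "pochhammer (- z) n \<noteq> 0" by auto
        then have "rGamma (of_nat n - z) * Gamma (- z) = 1 / pochhammer (- z) n"
          using p by (simp add: field_simps)
        then have "(-1) ^ n * rGamma (of_nat n - z) * dominant_near a n m z
            = (-1) ^ n * (1 / pochhammer (- z) n) * node_diff a n m z"
          using dominant_near_eq[OF zm', of a n] by (metis mult.assoc)
        also have "\<dots> = ((-1) ^ n * (-1) ^ n) * s - (-1) ^ n * X"
          using p0 by (simp add: node_diff_def s(1) X_def diff_divide_distrib right_diff_distrib)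
        also have "(-1) ^ n * (-1) ^ n = (1 :: complex)"
          by (simp flip: power_mult_distrib)
        finally have "E z = (s - S n (z / of_nat n)) - (-1) ^ n * X"
          by (simp add: E_def)
        then have "norm (E z) \<le> norm (s - S n (z / of_nat n)) + norm X"
          using norm_triangle_ineq4[of "s - S n (z / of_nat n)" "(-1) ^ n * X"] by (simp add: norm_mult norm_power)
        also have "\<dots> \<le> M1 / real n ^ N + M2 / real n ^ N"
          using s(2) X by (rule add_mono)
        also have "\<dots> \<le> (\<bar>M1\<bar> + \<bar>M2\<bar>) / real n ^ N"
          unfolding add_divide_distrib[symmetric] by (intro divide_right_mono) auto
        finally show ?thesis .
      qed
      have "norm (E x) \<le> (\<bar>M1\<bar> + \<bar>M2\<bar>) / real n ^ N"
      proof (rule maximum_modulus_frontier[of E "cball (of_nat m) (1 / 2)"])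
        show "E holomorphic_on interior (cball (of_nat m) (1 / 2))"
          using holE by (rule holomorphic_on_subset) (rule interior_subset)
        show "continuous_on (closure (cball (of_nat m) (1 / 2))) E"
          using holE by (simp add: holomorphic_on_imp_continuous_on)
        show "x \<in> cball (of_nat m) (1 / 2)"
          using xm by (simp add: dist_norm norm_minus_commute)
      qed (use circle in auto)
      then show ?thesis
        using True by (simp add: E_def dominant_def x_def[symmetric] m_def[symmetric] yx[symmetric])
    qed
  qed
  have "\<forall>\<^sub>F n in sequentially. real n \<ge> 2 / c"
    by real_asymp
  then show ?thesis
    using main unfolding S_def by (intro exI[of _ "\<bar>M1\<bar> + \<bar>M2\<bar>"]) (auto elim!: eventually_mono)
qed

section \<open>The solution pair and the remainder\<close>

lemma analytic_on_ball_0_1: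
  "f holomorphic_on - {1 :: complex} \<Longrightarrow> f analytic_on ball 0 1"
  unfolding analytic_on_open[OF open_ball] by (erule holomorphic_on_subset) auto

lemma of_nat_minus_notin_nonpos_Ints:
  fixes x :: complex
  assumes "norm x < real n"
  shows "of_nat n - x \<notin> \<int>\<^sub>\<le>\<^sub>0"
  using complex_Re_le_cmod[of x] assms by (intro Re_pos_notin_nonpos_Ints) simp

lemma Gamma_of_nat_minus_nonzero:
  fixes x :: complex
  assumes "norm x < real n"
  shows "Gamma (of_nat n - x) \<noteq> 0" "Gamma (of_nat n - x + 1) \<noteq> 0"
  using of_nat_minus_notin_nonpos_Ints[OF assms] of_nat_minus_notin_nonpos_Ints[of x "Suc n"] assms
  by (simp_all add: Gamma_eq_zero_iff algebra_simps)

lemma uniform_expansion_dominant: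
  assumes "a > 0"
  shows "uniform_expansion (dominant a) dominant_scale (charlier_coeff a)"
  unfolding uniform_expansion_def
proof (intro conjI allI impI)
  show "charlier_coeff a k analytic_on ball 0 1" for k
    by (intro analytic_on_ball_0_1 holomorphic_on_charlier_coeff assms)
next
  fix N :: nat and \<rho> :: real assume N: "1 \<le> N" and "0 < \<rho> \<and> \<rho> < 1"
  then have \<rho>: "0 < \<rho>" "\<rho> < 1" by auto
  from \<rho> have "1 - \<rho> > 0" by simp
  from dominant_expansion[OF assms this N] obtain M where
    M: "\<forall>\<^sub>F n in sequentially. \<forall>y. norm y < 1 \<and> 1 - \<rho> \<le> norm (1 - y) \<longrightarrow>
     norm ((-1) ^ n * rGamma (of_nat n - of_nat n * y) * dominant a n (of_nat n * y)
       - (\<Sum>m<N. charlier_coeff a m y / of_nat n ^ m)) \<le> M / real n ^ N" ..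
  show "\<exists>M. \<forall>\<^sub>F n in sequentially. \<forall>y. cmod y \<le> \<rho> \<longrightarrow>
      (\<exists>\<eta>. cmod \<eta> \<le> M / real n ^ N \<and> dominant a n (of_nat n * y) =
         dominant_scale n (of_nat n * y) * ((\<Sum>k<N. charlier_coeff a k y / of_nat n ^ k) + \<eta>))"
  proof (rule exI[of _ M], use M eventually_gt_at_top[of 0] in eventually_elim, intro allI impI)
    fix n :: nat and y :: complex
    assume M: "\<forall>y. norm y < 1 \<and> 1 - \<rho> \<le> norm (1 - y) \<longrightarrow>
     norm ((-1) ^ n * rGamma (of_nat n - of_nat n * y) * dominant a n (of_nat n * y)
       - (\<Sum>m<N. charlier_coeff a m y / of_nat n ^ m)) \<le> M / real n ^ N"
      and n: "0 < n" and y: "norm y \<le> \<rho>"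
    define q where "q = (-1) ^ n * rGamma (of_nat n - of_nat n * y) * dominant a n (of_nat n * y)"
    have "norm (of_nat n * y) < real n"
      using y \<rho> n by (simp add: norm_mult)
    then have G: "rGamma (of_nat n - of_nat n * y) * Gamma (of_nat n - of_nat n * y) = 1"
      by (intro rGamma_mult_Gamma of_nat_minus_notin_nonpos_Ints)
    have "dominant_scale n (of_nat n * y) * q = ((-1) ^ n * (-1) ^ n) *
        (rGamma (of_nat n - of_nat n * y) * Gamma (of_nat n - of_nat n * y)) * dominant a n (of_nat n * y)"
      by (simp only: dominant_scale_def q_def mult_ac)
    also have "\<dots> = dominant a n (of_nat n * y)"
      unfolding G by (simp flip: power_mult_distrib)
    finally have "dominant a n (of_nat n * y) = dominant_scale n (of_nat n * y) * q" ..
    moreover have "1 - \<rho> \<le> norm (1 - y)"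
      using y norm_triangle_ineq2[of 1 y] by simp
    ultimately show "\<exists>\<eta>. cmod \<eta> \<le> M / real n ^ N \<and> dominant a n (of_nat n * y) =
         dominant_scale n (of_nat n * y) * ((\<Sum>k<N. charlier_coeff a k y / of_nat n ^ k) + \<eta>)"
      using M y \<rho> by (intro exI[of _ "q - (\<Sum>k<N. charlier_coeff a k y / of_nat n ^ k)"]) (auto simp: q_def)
  qed
qed

lemma uniform_expansion_subdominant:
  assumes "a > 0"
  shows "uniform_expansion (subdominant a) (subdominant_scale a) (kummer_coeff a)"
  unfolding uniform_expansion_def
proof (intro conjI allI impI)
  show "kummer_coeff a k analytic_on ball 0 1" for k
    by (intro analytic_on_ball_0_1 holomorphic_on_kummer_coeff assms)
next
  fix N :: nat and \<rho> :: real assume N: "1 \<le> N" and "0 < \<rho> \<and> \<rho> < 1"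
  then have \<rho>: "0 < \<rho>" "\<rho> < 1" by auto
  from subdominant_expansion[OF assms \<rho> N] obtain M where
    M: "\<forall>n\<ge>1. \<forall>y. norm y \<le> \<rho> \<longrightarrow>
     (\<exists>s. subdominant a n (of_nat n * y) = subdominant_scale a n (of_nat n * y) * s \<and>
        norm (s - (\<Sum>m<N. kummer_coeff a m y / of_nat n ^ m)) \<le> M / real n ^ N)" ..
  show "\<exists>M. \<forall>\<^sub>F n in sequentially. \<forall>y. cmod y \<le> \<rho> \<longrightarrow>
      (\<exists>\<eta>. cmod \<eta> \<le> M / real n ^ N \<and> subdominant a n (of_nat n * y) =
         subdominant_scale a n (of_nat n * y) * ((\<Sum>k<N. kummer_coeff a k y / of_nat n ^ k) + \<eta>))"
  proof (rule exI[of _ M], use eventually_ge_at_top[of 1] in eventually_elim, intro allI impI)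
    fix n :: nat and y :: complex
    assume n: "1 \<le> n" and y: "norm y \<le> \<rho>"
    obtain s where "subdominant a n (of_nat n * y) = subdominant_scale a n (of_nat n * y) * s"
        "norm (s - (\<Sum>m<N. kummer_coeff a m y / of_nat n ^ m)) \<le> M / real n ^ N"
      using M n y by blast
    then show "\<exists>\<eta>. cmod \<eta> \<le> M / real n ^ N \<and> subdominant a n (of_nat n * y) =
         subdominant_scale a n (of_nat n * y) * ((\<Sum>k<N. kummer_coeff a k y / of_nat n ^ k) + \<eta>)"
      by (intro exI[of _ "s - (\<Sum>k<N. kummer_coeff a k y / of_nat n ^ k)"]) auto
  qed
qed

section \<open>Pointwise asymptotics in n and linear independence\<close>

lemma uniform_expansion_imp_ratio_tendsto:
  assumes "uniform_expansion u g c" and "isCont (c 0) 0"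
    and g: "\<forall>\<^sub>F n in sequentially. g n x \<noteq> 0"
  shows "(\<lambda>n. u n x / g n x) \<longlonglongrightarrow> c 0 0"
proof -
  \<comment> \<open>For fixed x the point y = x/n tends to 0 and eventually enters any fixed disc
    around 0; order N = 1 already determines the limit.\<close>
  have "(0::real) < 1 / 2 \<and> 1 / 2 < (1::real)" by simp
  then obtain M where M: "\<forall>\<^sub>F n in sequentially. \<forall>y. cmod y \<le> 1 / 2 \<longrightarrow>
      (\<exists>\<eta>. cmod \<eta> \<le> M / real n ^ 1 \<and>
        u n (of_nat n * y) = g n (of_nat n * y) * ((\<Sum>k<1. c k y / of_nat n ^ k) + \<eta>))"
    using assms(1) unfolding uniform_expansion_def by blast
  have "(\<lambda>n. u n x / g n x - c 0 (x / of_nat n)) \<longlonglongrightarrow> 0"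
  proof (rule Lim_null_comparison)
    show "(\<lambda>n. M / real n) \<longlonglongrightarrow> 0"
      by real_asymp
    have "\<forall>\<^sub>F n in sequentially. 2 * norm x \<le> real n"
      by real_asymp
    then show "\<forall>\<^sub>F n in sequentially. norm (u n x / g n x - c 0 (x / of_nat n)) \<le> M / real n"
      using M g eventually_gt_at_top[of 0]
    proof eventually_elim
      case (elim n)
      then have "cmod (x / of_nat n) \<le> 1 / 2" "of_nat n * (x / of_nat n) = x"
        by (auto simp: norm_divide field_simps)
      then obtain \<eta> where "cmod \<eta> \<le> M / real n" "u n x = g n x * (c 0 (x / of_nat n) + \<eta>)"
        using elim(2)[rule_format, of "x / of_nat n"] by auto
      then show ?case using elim by simp
    qed
  qed
  moreover have "(\<lambda>n. c 0 (x / of_nat n)) \<longlonglongrightarrow> c 0 0"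
  proof (rule isCont_tendsto_compose[OF assms(2)])
    have "(\<lambda>n. x * (1 / of_nat n)) \<longlonglongrightarrow> x * 0"
      by (intro tendsto_mult tendsto_const lim_1_over_n)
    then show "(\<lambda>n. x / of_nat n) \<longlonglongrightarrow> 0" by simp
  qed
  ultimately have "(\<lambda>n. (u n x / g n x - c 0 (x / of_nat n)) + c 0 (x / of_nat n)) \<longlonglongrightarrow> 0 + c 0 0"
    by (rule tendsto_add)
  then show ?thesis by simp
qed

lemma eventually_scales_nonzero:
  assumes "a > 0"
  shows "\<forall>\<^sub>F n in sequentially. dominant_scale n x \<noteq> 0"
    and "\<forall>\<^sub>F n in sequentially. subdominant_scale a n x \<noteq> 0"
proof -
  have ev: "\<forall>\<^sub>F n in sequentially. norm x < real n"
    by real_asymp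
  show "\<forall>\<^sub>F n in sequentially. dominant_scale n x \<noteq> 0"
    using ev by eventually_elim (simp add: dominant_scale_def Gamma_of_nat_minus_nonzero)
  show "\<forall>\<^sub>F n in sequentially. subdominant_scale a n x \<noteq> 0"
    using ev
  proof eventually_elim
    case (elim n)
    have "Gamma (of_nat n + 1) = (fact n :: complex)"
      using Gamma_fact[of n] by (simp add: add_ac)
    then show ?case
      using Gamma_of_nat_minus_nonzero(2)[OF elim] assms by (simp add: subdominant_scale_def)
  qed
qed

lemma dominant_ratio_tendsto:
  assumes "a > 0"
  shows "(\<lambda>n. dominant a n x / dominant_scale n x) \<longlonglongrightarrow> exp (of_real a)"
proof -
  have "isCont (charlier_coeff a 0) 0"
    unfolding charlier_coeff_0[abs_def] by (intro continuous_intros) auto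
  from uniform_expansion_imp_ratio_tendsto[OF uniform_expansion_dominant[OF assms] this
      eventually_scales_nonzero(1)[OF assms]]
  show ?thesis by (simp add: charlier_coeff_0)
qed

lemma subdominant_ratio_tendsto:
  assumes "a > 0"
  shows "(\<lambda>n. subdominant a n x / subdominant_scale a n x) \<longlonglongrightarrow> 1"
proof -
  have "isCont (kummer_coeff a 0) 0"
    unfolding kummer_coeff_0[abs_def] by (intro continuous_intros) auto
  from uniform_expansion_imp_ratio_tendsto[OF uniform_expansion_subdominant[OF assms] this
      eventually_scales_nonzero(2)[OF assms]]
  show ?thesis by (simp add: kummer_coeff_0)
qed

text \<open>Consecutive values have the quotient a (n+1)/((n-x)(n-x+1)), of order 1/n, so the ratio
  test gives even summability.\<close>

lemma scale_ratio_tendsto_0: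
  assumes "a > 0"
  shows "(\<lambda>n. subdominant_scale a n x / dominant_scale n x) \<longlonglongrightarrow> 0"
proof -
  define R where "R = norm x"
  define r where "r n = subdominant_scale a n x / dominant_scale n x" for n
  have "\<forall>\<^sub>F n in sequentially. R < real n \<and> a * (real n + 1) / ((real n - R) * (real n - R)) < 1 / 2"
    by (intro eventually_conj) real_asymp+
  then obtain n0 where n0: "\<And>n. n \<ge> n0 \<Longrightarrow> R < real n"
      "\<And>n. n \<ge> n0 \<Longrightarrow> a * (real n + 1) / ((real n - R) * (real n - R)) < 1 / 2"
    unfolding eventually_sequentially by blast
  have "summable r"
  proof (rule summable_ratio_test)
    fix n assume n: "n \<ge> n0"
    define z where "z = of_nat n - x"
    have nR: "norm x < real n" using n0(1)[OF n] by (simp add: R_def)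
    have z: "z \<notin> \<int>\<^sub>\<le>\<^sub>0" "z + 1 \<notin> \<int>\<^sub>\<le>\<^sub>0"
      using of_nat_minus_notin_nonpos_Ints[OF nR] of_nat_minus_notin_nonpos_Ints[of x "Suc n"] nR
      by (auto simp: z_def algebra_simps)
    have zn: "real n - R \<le> norm z" "real n - R \<le> norm (z + 1)"
    proof -
      have "real n - R \<le> norm z"
        using norm_triangle_ineq2[of "of_nat n" x] by (simp add: z_def R_def)
      moreover have "real (Suc n) - R \<le> norm (of_nat (Suc n) - x)"
        using norm_triangle_ineq2[of "of_nat (Suc n)" x] unfolding norm_of_nat R_def .
      moreover have "of_nat (Suc n) - x = z + 1"
        by (simp add: z_def)
      ultimately show "real n - R \<le> norm z" "real n - R \<le> norm (z + 1)"
        by (simp_all only:)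
    qed
    have r_Suc: "r (Suc n) = r n * (of_real a * (of_nat n + 1) / (z * (z + 1)))"
    proof -
      have "(of_nat n + 1 :: complex) \<notin> \<int>\<^sub>\<le>\<^sub>0"
        by (intro Re_pos_notin_nonpos_Ints) simp
      then have "Gamma (of_nat (Suc n) + 1) = (of_nat n + 1) * (Gamma (of_nat n + 1) :: complex)"
        using Gamma_plus1[of "of_nat n + 1 :: complex"] by (simp add: add_ac)
      moreover have "Gamma (of_nat (Suc n) - x + 1) = (z + 1) * Gamma (z + 1)"
        using Gamma_plus1[OF z(2)] by (simp add: z_def algebra_simps)
      moreover have "Gamma (of_nat (Suc n) - x) = z * Gamma z"
        using Gamma_plus1[OF z(1)] by (simp add: z_def algebra_simps)
      ultimately show ?thesis
        by (simp add: r_def subdominant_scale_def dominant_scale_def mult_ac flip: z_def)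
    qed
    have "norm (r (Suc n)) = norm (r n) * (a * (real n + 1) / (norm z * norm (z + 1)))"
    proof -
      have "norm (of_nat n + 1 :: complex) = real n + 1"
        using norm_of_nat[of "Suc n", where ?'a = complex] by (simp add: add_ac)
      then show ?thesis
        using assms r_Suc by (simp add: norm_mult norm_divide)
    qed
    also have "\<dots> \<le> norm (r n) * (a * (real n + 1) / ((real n - R) * (real n - R)))"
      using zn n0(1)[OF n] assms by (intro mult_left_mono divide_left_mono mult_mono mult_pos_pos) auto
    also have "\<dots> \<le> norm (r n) * (1 / 2)"
      using n0(2)[OF n] by (intro mult_left_mono) auto
    finally show "norm (r (Suc n)) \<le> 1 / 2 * norm (r n)" by simp
  qed simp
  then show ?thesis
    unfolding r_def by (rule summable_LIMSEQ_zero)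
qed

lemma subdominant_over_dominant_tendsto_0:
  assumes "a > 0"
  shows "(\<lambda>n. subdominant a n x / dominant a n x) \<longlonglongrightarrow> 0"
proof -
  have "(\<lambda>n. (subdominant a n x / subdominant_scale a n x) *
      (subdominant_scale a n x / dominant_scale n x) / (dominant a n x / dominant_scale n x))
      \<longlonglongrightarrow> 1 * 0 / exp (of_real a)"
    by (intro tendsto_mult tendsto_divide subdominant_ratio_tendsto scale_ratio_tendsto_0
        dominant_ratio_tendsto assms) auto
  moreover have "\<forall>\<^sub>F n in sequentially. (subdominant a n x / subdominant_scale a n x) *
      (subdominant_scale a n x / dominant_scale n x) / (dominant a n x / dominant_scale n x)
      = subdominant a n x / dominant a n x"
    using eventually_scales_nonzero[OF assms, of x] by eventually_elim simp
  ultimately show ?thesis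
    by (auto elim: Lim_transform_eventually)
qed

text \<open>Dividing by the dominant solution, nonzero for large n, and letting n tend to infinity
  isolates \<alpha>; an index at which the subdominant solution is nonzero then settles
  \<beta>.\<close>

lemma solutions_independent:
  assumes a: "a > 0" and zero: "\<And>n. \<alpha> * dominant a n x + \<beta> * subdominant a n x = 0"
  shows "\<alpha> = 0 \<and> \<beta> = 0"
proof -
  have "\<forall>\<^sub>F n in sequentially. dominant a n x / dominant_scale n x \<noteq> 0"
    using dominant_ratio_tendsto[OF a] by (rule tendsto_imp_eventually_ne) simp
  then have "\<forall>\<^sub>F n in sequentially. \<alpha> + \<beta> * (subdominant a n x / dominant a n x) = 0"
  proof eventually_elim
    case (elim n)
    then show ?case using zero[of n] by (auto simp: field_simps)
  qed
  then have "(\<lambda>n. \<alpha> + \<beta> * (subdominant a n x / dominant a n x)) \<longlonglongrightarrow> 0"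
    by (rule tendsto_eventually)
  moreover have "(\<lambda>n. \<alpha> + \<beta> * (subdominant a n x / dominant a n x)) \<longlonglongrightarrow> \<alpha> + \<beta> * 0"
    by (intro tendsto_intros subdominant_over_dominant_tendsto_0 a)
  ultimately have \<alpha>: "\<alpha> = 0"
    using LIMSEQ_unique by fastforce
  have "\<forall>\<^sub>F n in sequentially. subdominant a n x / subdominant_scale a n x \<noteq> 0"
    using subdominant_ratio_tendsto[OF a] by (rule tendsto_imp_eventually_ne) simp
  then obtain n where "subdominant a n x / subdominant_scale a n x \<noteq> 0"
    using eventually_happens trivial_limit_sequentially by blast
  then show ?thesis
    using zero[of n] \<alpha> by auto
qed

text \<open>Here a n/(n-x) = a/(1-y), and exp(-a y/(1-y)) = e^a exp(-a/(1-y)): the leading Kummer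
  coefficient is the prescribed exponential up to the constant e^a.\<close>

lemma subdominant_leading_uniform_limit:
  assumes a: "a > 0" and \<rho>: "0 < \<rho>" "\<rho> < 1"
  shows "uniform_limit (cball 0 \<rho>)
    (\<lambda>n y. let x = of_nat n * y in
       subdominant a n x / (subdominant_scale a n x * exp (- (of_real a * of_nat n / (of_nat n - x)))))
    (\<lambda>_. exp (of_real a)) sequentially"
proof -
  from subdominant_expansion[OF a \<rho> order_refl] obtain M where
    M: "\<forall>n\<ge>1. \<forall>y. norm y \<le> \<rho> \<longrightarrow>
     (\<exists>s. subdominant a n (of_nat n * y) = subdominant_scale a n (of_nat n * y) * s \<and>
        norm (s - (\<Sum>m<1. kummer_coeff a m y / of_nat n ^ m)) \<le> M / real n ^ 1)" ..
  define E where "E = exp (a / (1 - \<rho>))"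
  have bound: "norm (subdominant a n (of_nat n * y) / (subdominant_scale a n (of_nat n * y) *
      exp (- (of_real a * of_nat n / (of_nat n - of_nat n * y)))) - exp (of_real a)) \<le> M * E / real n"
    if n: "n \<ge> 1" and y: "norm y \<le> \<rho>" for n y
  proof -
    obtain s where s: "subdominant a n (of_nat n * y) = subdominant_scale a n (of_nat n * y) * s"
        "norm (s - exp (- (of_real a * y / (1 - y)))) \<le> M / real n"
      using M[rule_format, OF n y] by (auto simp: kummer_coeff_0)
    have y1: "y \<noteq> 1" using y \<rho> by auto
    have "norm (of_nat n * y) < real n"
      using y \<rho> n by (simp add: norm_mult)
    from Gamma_of_nat_minus_nonzero(2)[OF this] Gamma_fact[of n, where ?'a = complex]
    have sc: "subdominant_scale a n (of_nat n * y) \<noteq> 0"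
      using a by (simp add: subdominant_scale_def add_ac)
    have e: "of_real a * of_nat n / (of_nat n - of_nat n * y) = of_real a / (1 - y)"
      using n y1 by (simp add: field_simps)
    have "subdominant a n (of_nat n * y) / (subdominant_scale a n (of_nat n * y) *
        exp (- (of_real a / (1 - y)))) = s * exp (of_real a / (1 - y))"
      unfolding s(1) using sc by (simp add: exp_minus field_simps)
    moreover have "exp (of_real a) = exp (- (of_real a * y / (1 - y))) * exp (of_real a / (1 - y))"
    proof -
      have "of_real a / (1 - y) - of_real a * y / (1 - y) = of_real a * (1 - y) / (1 - y)"
        by (simp add: right_diff_distrib flip: diff_divide_distrib)
      then show ?thesis
        using y1 by (simp flip: exp_add)
    qed
    ultimately have "subdominant a n (of_nat n * y) / (subdominant_scale a n (of_nat n * y) *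
        exp (- (of_real a / (1 - y)))) - exp (of_real a)
        = (s - exp (- (of_real a * y / (1 - y)))) * exp (of_real a / (1 - y))"
      by (simp add: algebra_simps)
    also have "norm \<dots> \<le> M / real n * E"
      unfolding norm_mult
    proof (rule mult_mono)
      have "1 - \<rho> \<le> norm (1 - y)"
        using y norm_triangle_ineq2[of 1 y] by simp
      then have "norm (of_real a / (1 - y)) \<le> a / (1 - \<rho>)"
        using a \<rho> by (simp add: norm_divide frac_le)
      then show "norm (exp (of_real a / (1 - y))) \<le> E"
        unfolding E_def by (intro order_trans[OF norm_exp]) simp
      show "0 \<le> M / real n" using s(2) norm_ge_zero order_trans by blast
    qed (use s(2) in auto)
    finally show ?thesis
      unfolding e by simp
  qed
  show ?thesis
  proof (rule uniform_limitI)
    fix e :: real assume "e > 0"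
    have "(\<lambda>n. M * E / real n) \<longlonglongrightarrow> 0"
      by real_asymp
    then have "\<forall>\<^sub>F n in sequentially. M * E / real n < e"
      using \<open>e > 0\<close> by (rule order_tendstoD)
    then show "\<forall>\<^sub>F n in sequentially. \<forall>y\<in>cball 0 \<rho>. dist (let x = of_nat n * y in
       subdominant a n x / (subdominant_scale a n x * exp (- (of_real a * of_nat n / (of_nat n - x)))))
       (exp (of_real a)) < e"
      using eventually_ge_at_top[of 1]
    proof eventually_elim
      case (elim n)
      then show ?case
        by (auto simp: dist_norm Let_def intro!: le_less_trans[OF bound])
    qed
  qed
qed

lemma charlier_solution_pair_dominant_subdominant:
  assumes "a > 0"
  shows "charlier_solution_pair a (dominant a) (subdominant a)"
  unfolding charlier_solution_pair_def
proof (intro conjI allI impI)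
  show "charlier_rec a (dominant a)" "charlier_rec a (subdominant a)"
    by (intro charlier_rec_dominant charlier_rec_subdominant assms)+
  show "\<alpha> = 0" "\<beta> = 0" if "\<forall>n. \<alpha> * dominant a n x + \<beta> * subdominant a n x = 0" for x \<alpha> \<beta>
    using solutions_independent[OF assms] that by blast+
  show "(\<lambda>n. subdominant a n x / dominant a n x) \<longlonglongrightarrow> 0" for x
    by (rule subdominant_over_dominant_tendsto_0[OF assms])
  show "\<exists>\<phi>. uniform_expansion (dominant a) dominant_scale \<phi>"
    using uniform_expansion_dominant[OF assms] by blast
  show "\<exists>\<psi>. uniform_expansion (subdominant a) (subdominant_scale a) \<psi>"
    using uniform_expansion_subdominant[OF assms] by blast
  show "\<exists>c. c \<noteq> 0 \<and> (\<forall>x. (\<lambda>n. dominant a n x / dominant_scale n x) \<longlonglongrightarrow> c)"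
    using dominant_ratio_tendsto[OF assms] by (intro exI[of _ "exp (of_real a)"]) auto
  show "\<exists>c. c \<noteq> 0 \<and> (\<forall>\<rho>. 0 < \<rho> \<and> \<rho> < 1 \<longrightarrow> uniform_limit (cball 0 \<rho>)
          (\<lambda>n y. let x = of_nat n * y in subdominant a n x /
             (subdominant_scale a n x * exp (- (of_real a * of_nat n / (of_nat n - x)))))
          (\<lambda>_. c) sequentially)"
    using subdominant_leading_uniform_limit[OF assms]
    by (intro exI[of _ "exp (of_real a)"] conjI allI impI) auto
qed

section \<open>Leading approximation and vanishing of the remainder\<close>

definition charlier_remainder :: "real \<Rightarrow> nat \<Rightarrow> complex \<Rightarrow> complex" where
  "charlier_remainder a n y =
     (if norm y < 1 then node_weight a (of_nat n * y) * subdominant a n (of_nat n * y) else 0)"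

text \<open>The expansions give an error added to exp(a/(1-y)). It becomes a relative error because
  the inverse of this exponential is bounded by exp(a/\<delta>).\<close>

lemma charlier_leading_approx:
  assumes a: "a > 0" and \<delta>: "\<delta> > 0"
  shows "\<exists>M. \<forall>\<^sub>F n in sequentially. \<forall>y. \<delta> < norm (y - 1) \<longrightarrow> (\<exists>\<eta>. norm \<eta> \<le> M / real n \<and>
     charlier a n (of_nat n * y) = charlier_leading a n y * (1 + \<eta>) + charlier_remainder a n y)"
proof -
  from charlier_expansion[OF a \<delta>, of 1] obtain M1 where
    M1: "\<forall>n\<ge>1. \<forall>y. \<delta> \<le> norm (1 - y) \<and> (\<forall>j<n. 1 / 2 \<le> norm (of_nat n * y - of_nat j)) \<longrightarrow>
     (\<exists>s. charlier a n (of_nat n * y) = (-1) ^ n * pochhammer (- (of_nat n * y)) n * s \<and>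
        norm (s - (\<Sum>m<1. charlier_coeff a m y / of_nat n ^ m)) \<le> M1 / real n ^ 1)" by auto
  from dominant_expansion[OF a \<delta>, of 1] obtain M2 where
    M2: "\<forall>\<^sub>F n in sequentially. \<forall>y. norm y < 1 \<and> \<delta> \<le> norm (1 - y) \<longrightarrow>
     norm ((-1) ^ n * rGamma (of_nat n - of_nat n * y) * dominant a n (of_nat n * y)
       - (\<Sum>m<1. charlier_coeff a m y / of_nat n ^ m)) \<le> M2 / real n ^ 1" by auto
  define E where "E = exp (a / \<delta>)"
  define M where "M = E * (\<bar>M1\<bar> + \<bar>M2\<bar>)"
  show ?thesis
  proof (rule exI[of _ M], use M2 eventually_gt_at_top[of 0] in eventually_elim, intro allI impI)
    fix n :: nat and y :: complex
    assume M2: "\<forall>y. norm y < 1 \<and> \<delta> \<le> norm (1 - y) \<longrightarrow>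
       norm ((-1) ^ n * rGamma (of_nat n - of_nat n * y) * dominant a n (of_nat n * y)
         - (\<Sum>m<1. charlier_coeff a m y / of_nat n ^ m)) \<le> M2 / real n ^ 1"
      and n: "0 < n" and "\<delta> < norm (y - 1)"
    then have y: "\<delta> \<le> norm (1 - y)" by (simp add: norm_minus_commute)
    define x where "x = of_nat n * y"
    define e where "e = exp (of_real a / (1 - y))"
    have "norm (- (of_real a / (1 - y))) \<le> a / \<delta>"
      using a \<delta> y by (simp add: norm_divide frac_le)
    then have e: "norm (inverse e) \<le> E"
      unfolding e_def E_def exp_minus[symmetric] by (intro order_trans[OF norm_exp]) simp
    have e0: "e \<noteq> 0" by (simp add: e_def)
    have "\<exists>s. charlier a n x = (-1) ^ n * pochhammer (- x) n * s + charlier_remainder a n y \<and>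
        norm (s - e) \<le> (\<bar>M1\<bar> + \<bar>M2\<bar>) / real n"
    proof (cases "norm y < 1")
      case True
      define s where "s = (-1) ^ n * rGamma (of_nat n - x) * dominant a n x"
      have "norm x < real n"
        using True n by (simp add: x_def norm_mult)
      then have G: "rGamma (of_nat n - x) * Gamma (of_nat n - x) = 1"
        by (intro rGamma_mult_Gamma of_nat_minus_notin_nonpos_Ints)
      have "rGamma (- x) * dominant a n x = ((-1) ^ n * (-1) ^ n) * pochhammer (- x) n * rGamma (of_nat n - x) * dominant a n x"
        using pochhammer_rGamma[of "- x" n] by (simp flip: power_mult_distrib)
      also have "\<dots> = (-1) ^ n * pochhammer (- x) n * s"
        by (simp add: s_def)
      finally have "charlier a n x = (-1) ^ n * pochhammer (- x) n * s + charlier_remainder a n y"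
        using charlier_decomposition[OF a, of n x] True by (simp add: charlier_remainder_def x_def)
      moreover have "norm (s - e) \<le> M2 / real n"
        using M2 True y by (auto simp: s_def x_def e_def charlier_coeff_0)
      moreover have "M2 / real n \<le> (\<bar>M1\<bar> + \<bar>M2\<bar>) / real n"
        by (intro divide_right_mono) auto
      ultimately show ?thesis
        using order_trans by blast
    next
      case False
      \<comment> \<open>For |y| >= 1 a node j < n is at distance at least n-j >= 1 from x, so the
        expansion of the polynomial holds with no subdominant term.\<close>
      have "1 / 2 \<le> norm (x - of_nat j)" if "j < n" for j
      proof -
        have "real n * 1 \<le> real n * norm y"
          using False by (intro mult_left_mono) auto
        moreover have "norm x - real j \<le> norm (x - of_nat j)"
          using norm_triangle_ineq2[of x "of_nat j"] by simp
        ultimately show ?thesis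
          using that by (simp only: x_def norm_mult norm_of_nat)
      qed
      then obtain s where s: "charlier a n x = (-1) ^ n * pochhammer (- x) n * s"
          "norm (s - e) \<le> M1 / real n"
        using M1[rule_format, of n y] n y by (auto simp: x_def e_def charlier_coeff_0)
      have "M1 / real n \<le> (\<bar>M1\<bar> + \<bar>M2\<bar>) / real n"
        by (intro divide_right_mono) auto
      with s(2) have "norm (s - e) \<le> (\<bar>M1\<bar> + \<bar>M2\<bar>) / real n"
        by (rule order_trans)
      then show ?thesis
        using s(1) False by (intro exI[of _ s]) (simp add: charlier_remainder_def)
    qed
    then obtain s where s: "charlier a n x = (-1) ^ n * pochhammer (- x) n * s + charlier_remainder a n y"
        "norm (s - e) \<le> (\<bar>M1\<bar> + \<bar>M2\<bar>) / real n" by blast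
    define \<eta> where "\<eta> = inverse e * (s - e)"
    have "norm \<eta> \<le> E * ((\<bar>M1\<bar> + \<bar>M2\<bar>) / real n)"
      unfolding \<eta>_def norm_mult using e s(2) by (intro mult_mono) (auto simp: E_def)
    moreover have "s = e * (1 + \<eta>)"
      using e0 by (simp add: \<eta>_def algebra_simps)
    ultimately show "\<exists>\<eta>. norm \<eta> \<le> M / real n \<and>
        charlier a n (of_nat n * y) = charlier_leading a n y * (1 + \<eta>) + charlier_remainder a n y"
      using s(1) by (intro exI[of _ \<eta>])
        (simp add: M_def charlier_leading_def Gamma_quot_eq_pochhammer x_def e_def mult_ac)
  qed
qed

text \<open>If x were near a node m, then m <= n because |x| < n, so m/n would lie on the segment
  within 1/(2n) of y; n r >= 1 excludes this.\<close>

lemma charlier_remainder_eq_0: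
  assumes "r > 0" and n: "1 \<le> real n * r" and y: "r < infdist y (closed_segment 0 1)"
  shows "charlier_remainder a n y = 0"
proof (cases "norm y < 1")
  case True
  have "\<not> near_node (of_nat n * y)"
  proof
    assume "near_node (of_nat n * y)"
    then obtain m :: nat where m: "norm (of_nat n * y - of_nat m) < 1 / 2"
      by (auto simp: near_node_def)
    have n0: "n > 0" using n by (cases n) auto
    have "real m \<le> norm (of_nat n * y) + norm (of_nat n * y - of_nat m)"
      using norm_triangle_ineq4[of "of_nat n * y" "of_nat n * y - of_nat m"] by simp
    also have "\<dots> < real n + 1 / 2"
      using True n0 m by (intro add_strict_mono) (simp_all add: norm_mult)
    finally have "m \<le> n" by linarith
    then have "of_nat m / of_nat n \<in> closed_segment (0::complex) 1"
      using n0 unfolding in_segment by (intro exI[of _ "real m / real n"]) (auto simp: scaleR_conv_of_real)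
    then have "r < dist y (of_nat m / of_nat n)"
      using y infdist_le order_less_le_trans by blast
    also have "dist y (of_nat m / of_nat n) = norm (of_nat n * y - of_nat m) / real n"
    proof -
      have "y - of_nat m / of_nat n = (of_nat n * y - of_nat m) / of_nat n"
        using n0 by (simp add: field_simps)
      then show ?thesis by (simp add: dist_norm norm_divide)
    qed
    also have "\<dots> \<le> 1 / real n"
      using m by (intro divide_right_mono) auto
    also have "\<dots> \<le> r"
      using n n0 by (simp add: field_simps)
    finally show False by simp
  qed
  then show ?thesis
    by (simp add: charlier_remainder_def node_weight_def)
qed (simp add: charlier_remainder_def)

theorem theorem1:
  fixes a :: real
  assumes "a > 0"
  shows "\<exists>(Cd :: nat \<Rightarrow> complex \<Rightarrow> complex) (Cs :: nat \<Rightarrow> complex \<Rightarrow> complex)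
           (Kd :: complex \<Rightarrow> complex) (Ks :: complex \<Rightarrow> complex)
           (\<epsilon>\<^sub>1 :: nat \<Rightarrow> complex \<Rightarrow> complex).
     charlier_solution_pair a Cd Cs \<and>
     (\<forall>n x. charlier a n x = Kd x * Cd n x + Ks x * Cs n x) \<and>
     (\<forall>n y. cmod y < 1 \<longrightarrow> \<epsilon>\<^sub>1 n y = Ks (of_nat n * y) * Cs n (of_nat n * y)) \<and>
     (\<forall>\<delta>>0. \<exists>M. \<forall>\<^sub>F n in sequentially. \<forall>y. cmod (y - 1) > \<delta> \<longrightarrow>
        (\<exists>\<eta>. cmod \<eta> \<le> M / real n \<and>
           charlier a n (of_nat n * y) = charlier_leading a n y * (1 + \<eta>) + \<epsilon>\<^sub>1 n y)) \<and>
     (\<forall>r>0. \<exists>c>0. \<exists>M. \<forall>\<^sub>F n in sequentially. \<forall>y. infdist y (closed_segment 0 1) > r \<longrightarrow>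
        cmod (\<epsilon>\<^sub>1 n y) \<le> M * exp (- c * real n) * cmod (charlier_leading a n y))"
proof (intro exI conjI)
  show "charlier_solution_pair a (dominant a) (subdominant a)"
    by (rule charlier_solution_pair_dominant_subdominant[OF assms])
  show "\<forall>n x. charlier a n x = rGamma (- x) * dominant a n x + node_weight a x * subdominant a n x"
    using charlier_decomposition[OF assms] by blast
  show "\<forall>n y. cmod y < 1 \<longrightarrow>
      charlier_remainder a n y = node_weight a (of_nat n * y) * subdominant a n (of_nat n * y)"
    by (simp add: charlier_remainder_def)
  show "\<forall>\<delta>>0. \<exists>M. \<forall>\<^sub>F n in sequentially. \<forall>y. cmod (y - 1) > \<delta> \<longrightarrow> (\<exists>\<eta>. cmod \<eta> \<le> M / real n \<and>
      charlier a n (of_nat n * y) = charlier_leading a n y * (1 + \<eta>) + charlier_remainder a n y)"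
    using charlier_leading_approx[OF assms] by blast
  show "\<forall>r>0. \<exists>c>0. \<exists>M. \<forall>\<^sub>F n in sequentially. \<forall>y. infdist y (closed_segment 0 1) > r \<longrightarrow>
      cmod (charlier_remainder a n y) \<le> M * exp (- c * real n) * cmod (charlier_leading a n y)"
  proof (intro allI impI)
    fix r :: real assume r: "r > 0"
    have "\<forall>\<^sub>F n in sequentially. 1 \<le> real n * r"
      using r by real_asymp
    \<comment> \<open>Both sides are 0; the right one is written so that the witnesses M = 0 and c =
      1 can be read off.\<close>
    then have "\<forall>\<^sub>F n in sequentially. \<forall>y. infdist y (closed_segment 0 1) > r \<longrightarrow>
        cmod (charlier_remainder a n y) \<le> 0 * exp (- 1 * real n) * cmod (charlier_leading a n y)"
      by eventually_elim (simp add: charlier_remainder_eq_0[OF r])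
    then show "\<exists>c>0. \<exists>M. \<forall>\<^sub>F n in sequentially. \<forall>y. infdist y (closed_segment 0 1) > r \<longrightarrow>
        cmod (charlier_remainder a n y) \<le> M * exp (- c * real n) * cmod (charlier_leading a n y)"
      using zero_less_one by blast
  qed
qed

end
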